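(* Let $\Gamma=(N,A,\mathcal F,\Sigma,U)$ be a strategic form game. Suppose that $\Sigma$ is a compact and convex subset of a locally convex topological vector space, and that for each player $i\in N$ the payoff function $U_i\colon\Sigma\to\mathbb R$ is multi-linear and continuous. Then the set of perfect equilibria of $\Gamma$ is non-empty and compact.
   Context: A directed set $(I,\le)$ is a non-empty set with a reflexive, transitive relation such that every pair has an upper bound and there is no maximal element (for every $\alpha$ there is $\beta\ge\alpha$ with $\beta\neq\alpha$). Nets are indexed by directed sets; convergence is as usual. A field on a set $X$ is a collection of subsets containing $\emptyset$ and closed under complements and finite unions. A charge on a field is a finitely additive $[0,1]$-valued set function with total mass $1$; $\Xi(X)$ is the set of charges on the given field of $X$. A strategic form game is a tuple $\Gamma=(N,A,\mathcal F,\Sigma,U)$ where $N=\{1,\dots,n\}$; $A=\prod_{i\in N}A_i$ with each $A_i$ non-empty; $\mathcal F=(\mathcal F_1,\dots,\mathcal F_n)$ with $\mathcal F_i$ a field on $A_i$ containing all singletons; $\Sigma=\prod_{i\in N}\Sigma_i$ with $\emptyset\ne\Sigma_i\subseteq\Xi(A_i)$ endowed with a Hausdorff topology ($\Sigma$ has the product topology); and $U=(U_1,\dots,U_n)$ with $U_i\colon\Sigma\to\mathbb R$. When $\Sigma$ is regarded as a convex subset of a topological vector space, convex combinations are the usual (setwise, coordinatewise) convex combinations of charges and the topology is the subspace topology. Multi-linear means that $U_i$ respects convex combinations in each coordinate $\sigma_j$ separately. $(\tau_i\mid\sigma)$ is the profile $\sigma$ with $\sigma_i$ replaced by $\tau_i$.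 $\tau_i\in\Sigma_i$ is a best response to $\sigma\in\Sigma$ if $U_i(\tau_i\mid\sigma)\ge U_i(\tau_i'\mid\sigma)$ for all $\tau_i'\in\Sigma_i$; a profile $\tau$ is a best response to $\sigma$ if each $\tau_i$ is. $\sigma$ is a Nash equilibrium if it is a best response to itself. The carrier of $\sigma_i\in\Sigma_i$ is $\mathcal C_i(\sigma_i)=\{E\in\mathcal F_i\mid\sigma_i(E)>0\}$, and $\mathcal C(\sigma)=\prod_i\mathcal C_i(\sigma_i)$. A carrier is a set of the form $\mathcal C=\mathcal C(\sigma)$ with $\sigma\in\Sigma$. A net $(\sigma_\alpha)_{\alpha\in I}$ in $\Sigma$ is completely mixed if for every carrier $\mathcal C$ there is $\alpha\in I$ with $\mathcal C\subseteq\mathcal C(\sigma_\beta)$ for all $\beta\ge\alpha$. $\sigma\in\Sigma$ is perfect if there are a completely mixed net $(\sigma_\alpha)_{\alpha\in I}$ and a net $(\kappa_\alpha)_{\alpha\in I}$ in $\Sigma$, both converging to $\sigma$, such that $\kappa_\alpha$ is a best response to $\sigma_\alpha$ for each $\alpha\in I$. A perfect equilibrium is a Nash equilibrium that is perfect. *)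

theory Defs
  imports "HOL-Analysis.Analysis"
begin

section \<open>Directed sets and nets\<close>

definition directed_set :: "'i set \<Rightarrow> ('i \<Rightarrow> 'i \<Rightarrow> bool) \<Rightarrow> bool" where
  "directed_set I le \<longleftrightarrow>
     I \<noteq> {} \<and>
     (\<forall>\<alpha>\<in>I. le \<alpha> \<alpha>) \<and>
     (\<forall>\<alpha>\<in>I. \<forall>\<beta>\<in>I. \<forall>\<gamma>\<in>I. le \<alpha> \<beta> \<longrightarrow> le \<beta> \<gamma> \<longrightarrow> le \<alpha> \<gamma>) \<and>
     (\<forall>\<alpha>\<in>I. \<forall>\<beta>\<in>I. \<exists>\<gamma>\<in>I. le \<alpha> \<gamma> \<and> le \<beta> \<gamma>) \<and>
     (\<forall>\<alpha>\<in>I. \<exists>\<beta>\<in>I. le \<alpha> \<beta> \<and> \<beta> \<noteq> \<alpha>)"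

definition net_converges ::
  "'x topology \<Rightarrow> 'i set \<Rightarrow> ('i \<Rightarrow> 'i \<Rightarrow> bool) \<Rightarrow> ('i \<Rightarrow> 'x) \<Rightarrow> 'x \<Rightarrow> bool" where
  "net_converges X I le x l \<longleftrightarrow>
     l \<in> topspace X \<and>
     (\<forall>V. openin X V \<and> l \<in> V \<longrightarrow> (\<exists>\<alpha>\<in>I. \<forall>\<beta>\<in>I. le \<alpha> \<beta> \<longrightarrow> x \<beta> \<in> V))"


section \<open>Charges\<close>

text \<open>A set function on a field \<open>F\<close> is represented by its extension by \<open>0\<close> to all sets,
  so that charges on \<open>F\<close> are equal iff they agree on \<open>F\<close>, and setwise convex
  combinations are pointwise.\<close>

definition charges :: "'a set \<Rightarrow> 'a set set \<Rightarrow> ('a set \<Rightarrow> real) set" where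
  "charges X F =
     {\<mu>. (\<forall>E\<in>F. 0 \<le> \<mu> E \<and> \<mu> E \<le> 1) \<and> Measure_Space.additive F \<mu> \<and> \<mu> X = 1 \<and>
         (\<forall>E. E \<notin> F \<longrightarrow> \<mu> E = 0)}"

definition mix :: "real \<Rightarrow> ('a set \<Rightarrow> real) \<Rightarrow> ('a set \<Rightarrow> real) \<Rightarrow> 'a set \<Rightarrow> real" where
  "mix t \<mu> \<nu> = (\<lambda>E. (1 - t) * \<mu> E + t * \<nu> E)"


section \<open>Strategic form games\<close>

text \<open>Profiles are elements of \<open>PiE {1..n} _\<close>, hence \<open>undefined\<close> outside \<open>{1..n}\<close>.
  The action sets of the different players are subsets of one type \<open>'a\<close>.\<close>

type_synonym 'a profile = "nat \<Rightarrow> 'a set \<Rightarrow> real"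

record 'a game =
  num_players :: nat
  actions :: "nat \<Rightarrow> 'a set"
  action_field :: "nat \<Rightarrow> 'a set set"
  strategy_top :: "nat \<Rightarrow> ('a set \<Rightarrow> real) topology"
  payoff :: "nat \<Rightarrow> 'a profile \<Rightarrow> real"

definition players :: "'a game \<Rightarrow> nat set" where
  "players G = {1..num_players G}"

definition strategies :: "'a game \<Rightarrow> nat \<Rightarrow> ('a set \<Rightarrow> real) set" where
  "strategies G i = topspace (strategy_top G i)"

definition profiles :: "'a game \<Rightarrow> 'a profile set" where
  "profiles G = PiE (players G) (strategies G)"

definition profile_top :: "'a game \<Rightarrow> 'a profile topology" where
  "profile_top G = product_topology (strategy_top G) (players G)"

definition strategic_form_game :: "'a game \<Rightarrow> bool" where
  "strategic_form_game G \<longleftrightarrow>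
     (\<forall>i\<in>players G.
        actions G i \<noteq> {} \<and>
        algebra (actions G i) (action_field G i) \<and>
        (\<forall>a\<in>actions G i. {a} \<in> action_field G i) \<and>
        strategies G i \<noteq> {} \<and>
        strategies G i \<subseteq> charges (actions G i) (action_field G i) \<and>
        Hausdorff_space (strategy_top G i))"

definition mix_profile :: "'a game \<Rightarrow> real \<Rightarrow> 'a profile \<Rightarrow> 'a profile \<Rightarrow> 'a profile" where
  "mix_profile G t \<sigma> \<tau> = (\<lambda>i\<in>players G. mix t (\<sigma> i) (\<tau> i))"

definition multilinear_payoff :: "'a game \<Rightarrow> nat \<Rightarrow> bool" where
  "multilinear_payoff G i \<longleftrightarrow>
     (\<forall>\<sigma>\<in>profiles G. \<forall>j\<in>players G. \<forall>\<mu>\<in>strategies G j. \<forall>\<nu>\<in>strategies G j. \<forall>t\<in>{0..1}.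
        mix t \<mu> \<nu> \<in> strategies G j \<longrightarrow>
        payoff G i (\<sigma>(j := mix t \<mu> \<nu>)) =
          (1 - t) * payoff G i (\<sigma>(j := \<mu>)) + t * payoff G i (\<sigma>(j := \<nu>)))"

definition continuous_payoff :: "'a game \<Rightarrow> nat \<Rightarrow> bool" where
  "continuous_payoff G i \<longleftrightarrow> continuous_map (profile_top G) euclideanreal (payoff G i)"


section \<open>Equilibria\<close>

definition best_response_of :: "'a game \<Rightarrow> nat \<Rightarrow> ('a set \<Rightarrow> real) \<Rightarrow> 'a profile \<Rightarrow> bool" where
  "best_response_of G i \<mu> \<sigma> \<longleftrightarrow>
     \<mu> \<in> strategies G i \<and>
     (\<forall>\<nu>\<in>strategies G i. payoff G i (\<sigma>(i := \<mu>)) \<ge> payoff G i (\<sigma>(i := \<nu>)))"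

definition best_response :: "'a game \<Rightarrow> 'a profile \<Rightarrow> 'a profile \<Rightarrow> bool" where
  "best_response G \<tau> \<sigma> \<longleftrightarrow>
     \<tau> \<in> profiles G \<and> (\<forall>i\<in>players G. best_response_of G i (\<tau> i) \<sigma>)"

definition nash_equilibrium :: "'a game \<Rightarrow> 'a profile \<Rightarrow> bool" where
  "nash_equilibrium G \<sigma> \<longleftrightarrow> \<sigma> \<in> profiles G \<and> best_response G \<sigma> \<sigma>"

definition strategy_carrier :: "'a game \<Rightarrow> nat \<Rightarrow> ('a set \<Rightarrow> real) \<Rightarrow> 'a set set" where
  "strategy_carrier G i \<mu> = {E \<in> action_field G i. \<mu> E > 0}"

definition profile_carrier :: "'a game \<Rightarrow> 'a profile \<Rightarrow> (nat \<Rightarrow> 'a set) set" where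
  "profile_carrier G \<sigma> = (\<Pi>\<^sub>E i\<in>players G. strategy_carrier G i (\<sigma> i))"

definition is_carrier :: "'a game \<Rightarrow> (nat \<Rightarrow> 'a set) set \<Rightarrow> bool" where
  "is_carrier G C \<longleftrightarrow> (\<exists>\<sigma>\<in>profiles G. C = profile_carrier G \<sigma>)"

definition completely_mixed ::
  "'a game \<Rightarrow> 'i set \<Rightarrow> ('i \<Rightarrow> 'i \<Rightarrow> bool) \<Rightarrow> ('i \<Rightarrow> 'a profile) \<Rightarrow> bool" where
  "completely_mixed G I le s \<longleftrightarrow>
     (\<forall>C. is_carrier G C \<longrightarrow> (\<exists>\<alpha>\<in>I. \<forall>\<beta>\<in>I. le \<alpha> \<beta> \<longrightarrow> C \<subseteq> profile_carrier G (s \<beta>)))"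

definition perfect_along ::
  "'a game \<Rightarrow> 'i set \<Rightarrow> ('i \<Rightarrow> 'i \<Rightarrow> bool) \<Rightarrow> 'a profile \<Rightarrow> bool" where
  "perfect_along G I le \<sigma> \<longleftrightarrow>
     \<sigma> \<in> profiles G \<and> directed_set I le \<and>
     (\<exists>s k. (\<forall>\<alpha>\<in>I. s \<alpha> \<in> profiles G \<and> k \<alpha> \<in> profiles G) \<and>
            completely_mixed G I le s \<and>
            net_converges (profile_top G) I le s \<sigma> \<and>
            net_converges (profile_top G) I le k \<sigma> \<and>
            (\<forall>\<alpha>\<in>I. best_response G (k \<alpha>) (s \<alpha>)))"

text \<open>Perfection asks for some directed set, of any size. Since HOL cannot quantify
  existentially over types, the index set is taken in one sufficiently large type; the lemma
  \<open>perfect_along_imp_perfect\<close> below shows that index sets in arbitrary types \<open>'i\<close> give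
  nothing more.\<close>

definition perfect :: "'a game \<Rightarrow> 'a profile \<Rightarrow> bool" where
  "perfect G \<sigma> \<longleftrightarrow>
     (\<exists>(I :: ('a profile set \<times> 'a profile set \<times> nat) set) le. perfect_along G I le \<sigma>)"

definition perfect_equilibria :: "'a game \<Rightarrow> 'a profile set" where
  "perfect_equilibria G = {\<sigma>. nash_equilibrium G \<sigma> \<and> perfect G \<sigma>}"

lemma topspace_profile_top: "topspace (profile_top G) = profiles G"
  by (simp add: profile_top_def profiles_def strategies_def[abs_def] topspace_product_topology
      comp_def)

lemma directed_set_trans:
  assumes "directed_set I le" "u \<in> I" "v \<in> I" "w \<in> I" "le u v" "le v w"
  shows "le u w"
proof -
  have "\<forall>\<alpha>\<in>I. \<forall>\<beta>\<in>I. \<forall>\<gamma>\<in>I. le \<alpha> \<beta> \<longrightarrow> le \<beta> \<gamma> \<longrightarrow> le \<alpha> \<gamma>"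
    using assms(1) unfolding directed_set_def by (elim conjE)
  then show ?thesis using assms(2-) by blast
qed

lemma directed_set_upper_bound:
  assumes "directed_set I le" "u \<in> I" "v \<in> I"
  obtains w where "w \<in> I" "le u w" "le v w"
proof -
  have "\<forall>\<alpha>\<in>I. \<forall>\<beta>\<in>I. \<exists>\<gamma>\<in>I. le \<alpha> \<gamma> \<and> le \<beta> \<gamma>"
    using assms(1) unfolding directed_set_def by (elim conjE)
  then show thesis using assms(2-) that by blast
qed

lemma directed_set_eventually_finite:
  assumes I: "directed_set I le" and "finite F"
    and "\<forall>x\<in>F. \<exists>\<alpha>\<in>I. \<forall>\<beta>\<in>I. le \<alpha> \<beta> \<longrightarrow> P x \<beta>"
  shows "\<exists>\<alpha>\<in>I. \<forall>\<beta>\<in>I. le \<alpha> \<beta> \<longrightarrow> (\<forall>x\<in>F. P x \<beta>)"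
  using assms(2,3)
proof (induction F)
  case empty
  have "I \<noteq> {}" using I by (simp add: directed_set_def)
  then show ?case by blast
next
  case (insert x F)
  have "\<exists>\<alpha>\<in>I. \<forall>\<beta>\<in>I. le \<alpha> \<beta> \<longrightarrow> (\<forall>x\<in>F. P x \<beta>)"
    by (rule insert.IH) (use insert.prems in simp)
  then obtain a where a: "a \<in> I" and Pa: "\<And>\<beta> y. \<beta> \<in> I \<Longrightarrow> le a \<beta> \<Longrightarrow> y \<in> F \<Longrightarrow> P y \<beta>"
    by blast
  have "\<exists>\<alpha>\<in>I. \<forall>\<beta>\<in>I. le \<alpha> \<beta> \<longrightarrow> P x \<beta>"
    using insert.prems by simp
  then obtain b where b: "b \<in> I" and Pb: "\<And>\<beta>. \<beta> \<in> I \<Longrightarrow> le b \<beta> \<Longrightarrow> P x \<beta>"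
    by blast
  obtain c where c: "c \<in> I" "le a c" "le b c"
    using directed_set_upper_bound[OF I a b] .
  have "\<forall>y\<in>insert x F. P y \<beta>" if "\<beta> \<in> I" "le c \<beta>" for \<beta>
    using Pa[OF that(1) directed_set_trans[OF I a c(1) that(1) c(2) that(2)]]
      Pb[OF that(1) directed_set_trans[OF I b c(1) that(1) c(3) that(2)]] by simp
  then show ?case using c(1) by blast
qed

lemma perfect_along_imp_perfect:
  fixes G :: "'a game" and I :: "'i set"
  assumes "perfect_along G I le \<sigma>"
  shows "perfect G \<sigma>"
proof -
  from assms obtain s k where \<sigma>: "\<sigma> \<in> profiles G" and I: "directed_set I le"
    and sk: "\<forall>\<alpha>\<in>I. s \<alpha> \<in> profiles G \<and> k \<alpha> \<in> profiles G"
    and cm: "completely_mixed G I le s"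
    and cs: "net_converges (profile_top G) I le s \<sigma>"
    and ck: "net_converges (profile_top G) I le k \<sigma>"
    and br: "\<forall>\<alpha>\<in>I. best_response G (k \<alpha>) (s \<alpha>)"
    unfolding perfect_along_def by blast
  define J :: "('a profile set \<times> 'a profile set \<times> nat) set"
    where "J = {(F, V, m). finite F \<and> F \<subseteq> profiles G \<and> openin (profile_top G) V \<and> \<sigma> \<in> V}"
  define le' :: "'a profile set \<times> 'a profile set \<times> nat \<Rightarrow> _ \<Rightarrow> bool"
    where "le' = (\<lambda>(F, V, m) (F', V', m'). F \<subseteq> F' \<and> V' \<subseteq> V \<and> m \<le> m')"
  have top: "openin (profile_top G) (profiles G)"
    using openin_topspace[of "profile_top G"] by (simp add: topspace_profile_top)
  have J: "directed_set J le'"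
    unfolding directed_set_def
  proof (intro conjI ballI impI)
    show "J \<noteq> {}" using top \<sigma> by (auto simp: J_def)
  next
    fix x assume "x \<in> J" then show "le' x x" by (auto simp: le'_def)
  next
    fix x y z assume "le' x y" "le' y z" then show "le' x z"
      by (auto simp: le'_def)
  next
    fix x y assume xy: "x \<in> J" "y \<in> J"
    obtain F V m F' V' m' where e: "x = (F, V, m)" "y = (F', V', m')"
      by (metis prod_cases3)
    have "(F \<union> F', V \<inter> V', max m m') \<in> J" using xy by (auto simp: J_def e)
    then show "\<exists>z\<in>J. le' x z \<and> le' y z"
      by (rule bexI[rotated]) (auto simp: le'_def e)
  next
    fix x assume x: "x \<in> J"
    obtain F V m where e: "x = (F, V, m)" by (metis prod_cases3)
    have "(F, V, Suc m) \<in> J" using x by (auto simp: J_def e)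
    then show "\<exists>y\<in>J. le' x y \<and> y \<noteq> x"
      by (rule bexI[rotated]) (auto simp: le'_def e)
  qed
  have "\<exists>\<alpha>\<in>I. (\<forall>\<rho>\<in>fst x. profile_carrier G \<rho> \<subseteq> profile_carrier G (s \<alpha>)) \<and>
            s \<alpha> \<in> fst (snd x) \<and> k \<alpha> \<in> fst (snd x)" if x: "x \<in> J" for x
  proof -
    obtain F V m where e: "x = (F, V, m)" by (metis prod_cases3)
    have F: "finite F" "F \<subseteq> profiles G" and V: "openin (profile_top G) V" "\<sigma> \<in> V"
      using x by (auto simp: J_def e)
    have "\<exists>\<alpha>\<in>I. \<forall>\<beta>\<in>I. le \<alpha> \<beta> \<longrightarrow>
            (\<forall>\<rho>\<in>F. profile_carrier G \<rho> \<subseteq> profile_carrier G (s \<beta>))"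
    proof (rule directed_set_eventually_finite[OF I F(1)], rule ballI)
      fix \<rho> assume "\<rho> \<in> F"
      then have "is_carrier G (profile_carrier G \<rho>)" using F by (auto simp: is_carrier_def)
      then show "\<exists>\<alpha>\<in>I. \<forall>\<beta>\<in>I. le \<alpha> \<beta> \<longrightarrow>
          profile_carrier G \<rho> \<subseteq> profile_carrier G (s \<beta>)"
        using cm unfolding completely_mixed_def by blast
    qed
    then obtain a where a: "a \<in> I" "\<forall>\<beta>\<in>I. le a \<beta> \<longrightarrow>
            (\<forall>\<rho>\<in>F. profile_carrier G \<rho> \<subseteq> profile_carrier G (s \<beta>))" by blast
    obtain b where b: "b \<in> I" "\<forall>\<beta>\<in>I. le b \<beta> \<longrightarrow> s \<beta> \<in> V"
      using cs V unfolding net_converges_def by blast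
    obtain c where c: "c \<in> I" "\<forall>\<beta>\<in>I. le c \<beta> \<longrightarrow> k \<beta> \<in> V"
      using ck V unfolding net_converges_def by blast
    obtain d where d: "d \<in> I" "le a d" "le b d"
      using directed_set_upper_bound[OF I a(1) b(1)] .
    obtain d' where d': "d' \<in> I" "le d d'" "le c d'"
      using directed_set_upper_bound[OF I d(1) c(1)] .
    have "le a d'" "le b d'"
      using directed_set_trans[OF I a(1) d(1) d'(1) d(2) d'(2)] directed_set_trans[OF I b(1) d(1) d'(1) d(3) d'(2)] by auto
    then show ?thesis using a b c d' unfolding e by (intro bexI[of _ d']) auto
  qed
  then have "\<forall>x\<in>J. \<exists>\<alpha>. \<alpha> \<in> I \<and>
      (\<forall>\<rho>\<in>fst x. profile_carrier G \<rho> \<subseteq> profile_carrier G (s \<alpha>)) \<and>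
      s \<alpha> \<in> fst (snd x) \<and> k \<alpha> \<in> fst (snd x)"
    by blast
  from bchoice[OF this] obtain f where f: "\<And>x. x \<in> J \<Longrightarrow> f x \<in> I \<and>
      (\<forall>\<rho>\<in>fst x. profile_carrier G \<rho> \<subseteq> profile_carrier G (s (f x))) \<and>
      s (f x) \<in> fst (snd x) \<and> k (f x) \<in> fst (snd x)"
    by blast
  have cm': "completely_mixed G J le' (\<lambda>x. s (f x))"
    unfolding completely_mixed_def
  proof (intro allI impI)
    fix C assume "is_carrier G C"
    then obtain \<rho> where \<rho>: "\<rho> \<in> profiles G" "C = profile_carrier G \<rho>"
      by (auto simp: is_carrier_def)
    have "({\<rho>}, profiles G, 0) \<in> J" using \<rho> \<sigma> top by (auto simp: J_def)
    moreover have "C \<subseteq> profile_carrier G (s (f y))"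
      if "y \<in> J" "le' ({\<rho>}, profiles G, 0) y" for y
      using f[OF that(1)] that(2) \<rho>(2) by (auto simp: le'_def split: prod.splits)
    ultimately show "\<exists>x\<in>J. \<forall>y\<in>J. le' x y \<longrightarrow> C \<subseteq> profile_carrier G (s (f y))"
      by blast
  qed
  have conv: "net_converges (profile_top G) J le' (\<lambda>x. h (f x)) \<sigma>"
    if h: "\<And>x. x \<in> J \<Longrightarrow> h (f x) \<in> fst (snd x)" for h
    unfolding net_converges_def
  proof (intro conjI allI impI)
    show "\<sigma> \<in> topspace (profile_top G)" using \<sigma> by (simp add: topspace_profile_top)
  next
    fix V assume "openin (profile_top G) V \<and> \<sigma> \<in> V"
    then have "({}, V, 0) \<in> J" by (auto simp: J_def)
    moreover have "h (f y) \<in> V" if "y \<in> J" "le' ({}, V, 0) y" for y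
      using h[OF that(1)] that(2) by (auto simp: le'_def split: prod.splits)
    ultimately show "\<exists>x\<in>J. \<forall>y\<in>J. le' x y \<longrightarrow> h (f y) \<in> V" by blast
  qed
  have "perfect_along G J le' \<sigma>"
    unfolding perfect_along_def
  proof (intro conjI exI)
    show "net_converges (profile_top G) J le' (\<lambda>x. s (f x)) \<sigma>"
      by (rule conv) (simp add: f)
    show "net_converges (profile_top G) J le' (\<lambda>x. k (f x)) \<sigma>"
      by (rule conv) (simp add: f)
    show "\<forall>x\<in>J. s (f x) \<in> profiles G \<and> k (f x) \<in> profiles G"
      using sk f by blast
    show "\<forall>x\<in>J. best_response G (k (f x)) (s (f x))"
      using br f by blast
  qed (fact \<sigma> J cm')+
  then show ?thesis unfolding perfect_def by blast
qed


section \<open>Strategy spaces inside a topological vector space\<close>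

definition locally_convex_tvs :: "'v::real_vector topology \<Rightarrow> bool" where
  "locally_convex_tvs W \<longleftrightarrow>
     topspace W = UNIV \<and>
     continuous_map (prod_topology W W) W (\<lambda>(x, y). x + y) \<and>
     continuous_map (prod_topology euclideanreal W) W (\<lambda>(c, x). c *\<^sub>R x) \<and>
     (\<forall>V. openin W V \<and> 0 \<in> V \<longrightarrow> (\<exists>C. openin W C \<and> convex C \<and> 0 \<in> C \<and> C \<subseteq> V))"

text \<open>The map \<open>e\<close> identifies the set of profiles with a subset of the vector space: the
  product topology is the subspace topology, and a profile is a convex combination of two
  profiles in the vector space iff it is so setwise and coordinatewise. That the image is
  convex, i.e. that the set of profiles is closed under these combinations, is not part of
  the definition.\<close>

definition identifies_profiles ::
  "'a game \<Rightarrow> 'v::real_vector topology \<Rightarrow> ('a profile \<Rightarrow> 'v) \<Rightarrow> bool" where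
  "identifies_profiles G W e \<longleftrightarrow>
     embedding_map (profile_top G) W e \<and>
     (\<forall>\<sigma>\<in>profiles G. \<forall>\<tau>\<in>profiles G. \<forall>\<rho>\<in>profiles G. \<forall>t\<in>{0..1}.
        e \<rho> = (1 - t) *\<^sub>R e \<sigma> + t *\<^sub>R e \<tau> \<longleftrightarrow> \<rho> = mix_profile G t \<sigma> \<tau>)"

end

theory Submission
  imports Defs
begin

text \<open>
  Perturb the game towards a profile \<open>\<tau>\<close> whose carrier contains those of finitely many
  given profiles. The perturbed game has an equilibrium \<open>\<kappa>\<close>, i.e. \<open>\<kappa>\<close> is a best response to
  \<open>(1 - t) \<kappa> + t \<tau>\<close>: by Ky Fan's inequality applied to the total gain from unilateral deviations,
  some profile leaves no positive gain. Ky Fan's inequality reduces, by compactness, to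
  Brouwer's theorem on simplices of varying dimension, which comes from Kuhn's lemma on cubes in
  \<open>nat \<Rightarrow> real\<close>. As \<open>t\<close> tends to \<open>0\<close>, a cluster point of the \<open>\<kappa>\<close> is approximated by pairs of a
  profile dominating the given carriers and a best response to it. The profiles with this
  approximation property form a closed set; these sets have the finite intersection property, and
  their intersection is the set of perfect profiles, which are Nash equilibria by continuity.
\<close>

section \<open>Brouwer and Ky Fan\<close>

definition fun_cube :: "nat \<Rightarrow> (nat \<Rightarrow> real) set" where
  "fun_cube n = {x. \<forall>i. 0 \<le> x i \<and> x i \<le> (if i < n then 1 else 0)}"

text \<open>Coordinates from \<open>n\<close> on are pinned to 0, so that cubes of all dimensions
  share one type. The pinned factors are one-point intervals, and Tychonoff's theorem
  applies.\<close>

lemma compact_fun_cube: "compact (fun_cube n)"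
proof -
  have "fun_cube n = PiE UNIV (\<lambda>i. {0..if i < n then 1 else 0})"
    by (simp add: fun_cube_def PiE_def Pi_def set_eq_iff)
  then have "compactin (product_topology (\<lambda>_. euclidean) UNIV) (fun_cube n)"
    by (simp add: compactin_PiE del: atLeastAtMost_iff)
  then show ?thesis
    by (simp add: euclidean_product_topology)
qed

lemma tendsto_fun_iff:
  fixes f :: "'b \<Rightarrow> 'i \<Rightarrow> 'a::topological_space"
  shows "(f \<longlongrightarrow> l) F \<longleftrightarrow> (\<forall>i. ((\<lambda>x. f x i) \<longlongrightarrow> l i) F)"
  unfolding limitin_canonical_iff[symmetric] euclidean_product_topology[symmetric]
  by (simp add: limitin_componentwise)

text \<open>Kuhn's lemma on the grid of mesh \<open>1 / Suc m\<close> finds a cell in which every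
  coordinate receives both labels. Its lowest corner is \<open>x\<close>; the grid points
  \<open>r\<close> and \<open>s\<close> of the cell carry the two labels and depend on the
  coordinate \<open>i\<close>.\<close>

lemma fun_cube_approx_fixed_point:
  assumes f: "f ` fun_cube n \<subseteq> fun_cube n"
  shows "\<exists>x\<in>fun_cube n. \<forall>i<n. \<exists>r\<in>fun_cube n. \<exists>s\<in>fun_cube n.
    (\<forall>j. \<bar>r j - x j\<bar> \<le> 1 / real (Suc m) \<and> \<bar>s j - x j\<bar> \<le> 1 / real (Suc m)) \<and>
    r i \<le> f r i \<and> f s i \<le> s i"
proof -
  define p where "p = Suc m"
  have p: "0 < p" by (simp add: p_def)
  define pt where "pt x i = (if i < n then real (x i) / real p else 0)" for x :: "nat \<Rightarrow> nat" and i
  have 1: "\<forall>x. x \<in> fun_cube n \<longrightarrow> f x \<in> fun_cube n"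
    using f by blast
  have 2: "\<forall>x. x \<in> fun_cube n \<longrightarrow> (\<forall>i. i < n \<longrightarrow> 0 \<le> x i \<and> x i \<le> 1)"
    by (auto simp: fun_cube_def split: if_splits)
  \<comment> \<open>Label 0 implies that \<open>f\<close> does not decrease the coordinate, label 1
    that it does not increase it. The faces with coordinate 0 and 1 get labels 0 and 1, which is the
    boundary condition of Kuhn's lemma.\<close>
  from kuhn_labelling_lemma'[OF 1 2]
  obtain l :: "(nat \<Rightarrow> real) \<Rightarrow> nat \<Rightarrow> nat" where
    l1: "\<And>x i. l x i \<le> 1" and
    l2: "\<And>x i. x \<in> fun_cube n \<Longrightarrow> i < n \<Longrightarrow> x i = 0 \<Longrightarrow> l x i = 0" and
    l3: "\<And>x i. x \<in> fun_cube n \<Longrightarrow> i < n \<Longrightarrow> x i = 1 \<Longrightarrow> l x i = 1" and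
    l4: "\<And>x i. x \<in> fun_cube n \<Longrightarrow> i < n \<Longrightarrow> l x i = 0 \<Longrightarrow> x i \<le> f x i" and
    l5: "\<And>x i. x \<in> fun_cube n \<Longrightarrow> i < n \<Longrightarrow> l x i = 1 \<Longrightarrow> f x i \<le> x i"
    by blast
  have pt: "pt x \<in> fun_cube n" if "\<forall>i<n. x i \<le> p" for x
    using that p by (auto simp: fun_cube_def pt_def)
  obtain q where q: "\<forall>i<n. q i < p" and
    rs: "\<forall>i<n. \<exists>r s. (\<forall>j<n. q j \<le> r j \<and> r j \<le> q j + 1) \<and>
      (\<forall>j<n. q j \<le> s j \<and> s j \<le> q j + 1) \<and> l (pt r) i \<noteq> l (pt s) i"
  proof (rule kuhn_lemma[OF p, of n "\<lambda>x. l (pt x)"])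
    show "\<forall>x. (\<forall>i<n. x i \<le> p) \<longrightarrow> (\<forall>i<n. l (pt x) i = 0 \<or> l (pt x) i = 1)"
      using l1 by (metis One_nat_def le_SucE le_zero_eq)
    show "\<forall>x. (\<forall>i<n. x i \<le> p) \<longrightarrow> (\<forall>i<n. x i = 0 \<longrightarrow> l (pt x) i = 0)"
      using l2[OF pt] by (simp add: pt_def)
    show "\<forall>x. (\<forall>i<n. x i \<le> p) \<longrightarrow> (\<forall>i<n. x i = p \<longrightarrow> l (pt x) i = 1)"
      using l3[OF pt] p by (simp add: pt_def)
  qed blast
  have close: "\<bar>pt r j - pt q j\<bar> \<le> 1 / real (Suc m)" if "\<forall>j<n. q j \<le> r j \<and> r j \<le> q j + 1" for r j
  proof (cases "j < n")
    case True
    then have "real (q j) \<le> real (r j)" "real (r j) \<le> real (q j) + 1"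
      using that by (auto simp del: of_nat_le_iff simp flip: of_nat_Suc intro: of_nat_mono)
    then show ?thesis
      using True by (simp add: pt_def p_def divide_right_mono flip: diff_divide_distrib)
  qed (simp add: pt_def)
  have qc: "pt q \<in> fun_cube n" by (rule pt) (use q in \<open>auto simp: less_imp_le\<close>)
  show ?thesis
  proof (rule bexI[OF _ qc], intro allI impI)
    fix i assume i: "i < n"
    obtain r s where r: "\<forall>j<n. q j \<le> r j \<and> r j \<le> q j + 1" and
      s: "\<forall>j<n. q j \<le> s j \<and> s j \<le> q j + 1" and ne: "l (pt r) i \<noteq> l (pt s) i"
      using rs i by blast
    have rc: "pt r \<in> fun_cube n"
    proof (rule pt, intro allI impI)
      fix j assume "j < n"
      then have "q j < p" "r j \<le> q j + 1" using q r by auto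
      then show "r j \<le> p" by linarith
    qed
    have sc: "pt s \<in> fun_cube n"
    proof (rule pt, intro allI impI)
      fix j assume "j < n"
      then have "q j < p" "s j \<le> q j + 1" using q s by auto
      then show "s j \<le> p" by linarith
    qed
    \<comment> \<open>Kuhn's lemma does not tell which of the two points has label 0; in the second
      case they exchange roles.\<close>
    have "l (pt r) i = 0 \<and> l (pt s) i = 1 \<or> l (pt r) i = 1 \<and> l (pt s) i = 0"
      using l1[of "pt r" i] l1[of "pt s" i] ne by linarith
    then show "\<exists>r\<in>fun_cube n. \<exists>s\<in>fun_cube n.
        (\<forall>j. \<bar>r j - pt q j\<bar> \<le> 1 / real (Suc m) \<and> \<bar>s j - pt q j\<bar> \<le> 1 / real (Suc m)) \<and>
        r i \<le> f r i \<and> f s i \<le> s i"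
    proof
      assume "l (pt r) i = 0 \<and> l (pt s) i = 1"
      then show ?thesis
        using l4[OF rc i] l5[OF sc i] close[OF r] close[OF s]
        by (intro bexI[OF _ rc] bexI[OF _ sc]) simp
    next
      assume "l (pt r) i = 1 \<and> l (pt s) i = 0"
      then show ?thesis
        using l5[OF rc i] l4[OF sc i] close[OF r] close[OF s]
        by (intro bexI[OF _ sc] bexI[OF _ rc]) simp
    qed
  qed
qed

text \<open>The approximate fixed points for meshes tending to 0 accumulate at some
  \<open>z\<close>. The nearby points \<open>r\<close> and \<open>s\<close> tend to \<open>z\<close>
  as well, so by continuity both inequalities hold at \<open>z\<close>.\<close>

theorem brouwer_fun_cube:
  fixes f :: "(nat \<Rightarrow> real) \<Rightarrow> nat \<Rightarrow> real"
  assumes cont: "continuous_on (fun_cube n) f" and f: "f ` fun_cube n \<subseteq> fun_cube n"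
  shows "\<exists>x\<in>fun_cube n. f x = x"
proof -
  define P where "P i x m r s \<longleftrightarrow> r \<in> fun_cube n \<and> s \<in> fun_cube n \<and>
      (\<forall>j. \<bar>r j - x j\<bar> \<le> 1 / real (Suc m) \<and> \<bar>s j - x j\<bar> \<le> 1 / real (Suc m)) \<and>
      r i \<le> f r i \<and> f s i \<le> s i" for i x m r s
  have "\<forall>m. \<exists>x. x \<in> fun_cube n \<and> (\<forall>i<n. \<exists>r s. P i x m r s)"
  proof
    fix m
    obtain x where x: "x \<in> fun_cube n" and
      rs: "\<forall>i<n. \<exists>r\<in>fun_cube n. \<exists>s\<in>fun_cube n.
        (\<forall>j. \<bar>r j - x j\<bar> \<le> 1 / real (Suc m) \<and> \<bar>s j - x j\<bar> \<le> 1 / real (Suc m)) \<and>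
        r i \<le> f r i \<and> f s i \<le> s i"
      using fun_cube_approx_fixed_point[OF f, of m] by (rule bexE)
    have "\<exists>r s. P i x m r s" if "i < n" for i
      using rs[rule_format, OF that] by (simp only: P_def Bex_def ex_simps conj_assoc)
    then show "\<exists>x. x \<in> fun_cube n \<and> (\<forall>i<n. \<exists>r s. P i x m r s)"
      using x by blast
  qed
  then obtain X where X: "\<And>m. X m \<in> fun_cube n"
    and rs: "\<And>m i. i < n \<Longrightarrow> \<exists>r s. P i (X m) m r s"
    using choice[of "\<lambda>m x. x \<in> fun_cube n \<and> (\<forall>i<n. \<exists>r s. P i x m r s)"] by blast
  \<comment> \<open>Having countably many coordinates, the function space is first countable, so
    compactness of the cube gives convergent subsequences.\<close>
  obtain z \<phi> where z: "z \<in> fun_cube n" and \<phi>: "strict_mono \<phi>" and lim: "(X \<circ> \<phi>) \<longlonglongrightarrow> z"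
    by (rule seq_compactE[OF compact_imp_seq_compact[OF compact_fun_cube[of n]], of X]) (simp add: X)
  have close: "(\<lambda>m. Y (\<phi> m)) \<longlonglongrightarrow> z"
    if "\<And>m j. \<bar>Y m j - X m j\<bar> \<le> 1 / real (Suc m)" for Y
    unfolding tendsto_fun_iff
  proof
    fix j
    have "(\<lambda>m. Y m j - X m j) \<longlonglongrightarrow> 0"
    proof (rule Lim_null_comparison)
      show "\<forall>\<^sub>F m in sequentially. norm (Y m j - X m j) \<le> 1 / real (Suc m)"
        by (rule always_eventually) (simp only: real_norm_def that, simp)
      show "(\<lambda>m. 1 / real (Suc m)) \<longlonglongrightarrow> 0"
        using LIMSEQ_Suc[OF lim_1_over_n[where ?'a = real]] .
    qed
    from LIMSEQ_subseq_LIMSEQ[OF this \<phi>]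
    have "(\<lambda>m. Y (\<phi> m) j - X (\<phi> m) j) \<longlonglongrightarrow> 0" by (simp add: o_def)
    moreover have "(\<lambda>m. X (\<phi> m) j) \<longlonglongrightarrow> z j"
      using lim by (simp add: tendsto_fun_iff o_def)
    ultimately have "(\<lambda>m. (Y (\<phi> m) j - X (\<phi> m) j) + X (\<phi> m) j) \<longlonglongrightarrow> 0 + z j"
      by (rule tendsto_add)
    then show "(\<lambda>m. Y (\<phi> m) j) \<longlonglongrightarrow> z j" by simp
  qed
  have image: "(\<lambda>m. f (Y (\<phi> m)) i) \<longlonglongrightarrow> f z i"
    if "\<And>m j. \<bar>Y m j - X m j\<bar> \<le> 1 / real (Suc m)" "\<And>m. Y m \<in> fun_cube n" for Y i
  proof -
    have "(\<lambda>m. f (Y (\<phi> m))) \<longlonglongrightarrow> f z"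
      using continuous_on_tendsto_compose[OF cont close[OF that(1)] z] that(2) by simp
    then show ?thesis by (simp add: tendsto_fun_iff)
  qed
  have "f z i = z i" for i
  proof (cases "i < n")
    case True
    \<comment> \<open>The witnesses differ from coordinate to coordinate, so the two sequences are
      chosen for this \<open>i\<close> alone.\<close>
    obtain R S where
      R: "\<And>m. R m \<in> fun_cube n" "\<And>m j. \<bar>R m j - X m j\<bar> \<le> 1 / real (Suc m)" "\<And>m. R m i \<le> f (R m) i" and
      S: "\<And>m. S m \<in> fun_cube n" "\<And>m j. \<bar>S m j - X m j\<bar> \<le> 1 / real (Suc m)" "\<And>m. f (S m) i \<le> S m i"
    proof -
      have "\<forall>m. \<exists>r. \<exists>s. P i (X m) m r s"
        using rs[OF True] by blast
      then obtain R where "\<forall>m. \<exists>s. P i (X m) m (R m) s"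
        using choice[of "\<lambda>m r. \<exists>s. P i (X m) m r s"] by blast
      then obtain S where "\<And>m. P i (X m) m (R m) (S m)"
        using choice[of "\<lambda>m s. P i (X m) m (R m) s"] by blast
      then show thesis using that unfolding P_def by blast
    qed
    have lims: "(\<lambda>m. R (\<phi> m) i) \<longlonglongrightarrow> z i" "(\<lambda>m. S (\<phi> m) i) \<longlonglongrightarrow> z i"
      using close[OF R(2)] close[OF S(2)] by (simp_all only: tendsto_fun_iff)
    have "z i \<le> f z i" "f z i \<le> z i"
      using LIMSEQ_le[OF lims(1) image[OF R(2,1)]] LIMSEQ_le[OF image[OF S(2,1)] lims(2)] R(3) S(3)
      by blast+
    then show ?thesis by simp
  next
    case False
    \<comment> \<open>Beyond dimension \<open>n\<close> both \<open>z\<close> and \<open>f z\<close>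
      are pinned to 0.\<close>
    have zero: "x i = 0" if "x \<in> fun_cube n" for x
    proof -
      have "0 \<le> x i \<and> x i \<le> (if i < n then 1 else 0)"
        using that unfolding fun_cube_def by blast
      then show ?thesis using False by simp
    qed
    moreover have "f z \<in> fun_cube n" using z f by blast
    ultimately show ?thesis using zero z by metis
  qed
  then show ?thesis using z by blast
qed

section \<open>Ky Fan's inequality\<close>

lemma continuous_map_linear_combination:
  fixes W :: "'v::real_vector topology"
  assumes top: "topspace W = UNIV"
    and add: "continuous_map (prod_topology W W) W (\<lambda>(x, y). x + y)"
    and scale: "continuous_map (prod_topology euclideanreal W) W (\<lambda>(c, x). c *\<^sub>R x)"
    and "finite J" and a: "\<And>j. j \<in> J \<Longrightarrow> continuous_map X euclideanreal (a j)"
  shows "continuous_map X W (\<lambda>x. \<Sum>j\<in>J. a j x *\<^sub>R q j)"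
  using \<open>finite J\<close> a
proof (induction J)
  case empty
  then show ?case by (simp add: top)
next
  case (insert k J)
  \<comment> \<open>The topology \<open>W\<close> is a value, not a class instance, so continuity of
    the combination is assembled from that of scaling and addition.\<close>
  have "continuous_map X (prod_topology euclideanreal W) (\<lambda>x. (a k x, q k))"
    using insert.prems by (intro continuous_map_pairedI) (simp_all add: top)
  from continuous_map_compose[OF this scale]
  have "continuous_map X W (\<lambda>x. a k x *\<^sub>R q k)" by (simp add: o_def)
  then have "continuous_map X (prod_topology W W) (\<lambda>x. (a k x *\<^sub>R q k, \<Sum>j\<in>J. a j x *\<^sub>R q j))"
    using insert by (intro continuous_map_pairedI) simp_all
  from continuous_map_compose[OF this add] show ?case
    using insert.hyps by (simp add: o_def)
qed

text \<open>\<open>normalize_weights n\<close> retracts the cube onto the standard simplex: a deficit of total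
  mass is spread evenly, an excess is scaled away.\<close>

definition normalize_weights :: "nat \<Rightarrow> (nat \<Rightarrow> real) \<Rightarrow> nat \<Rightarrow> real" where
  "normalize_weights n x j =
     (x j + max 0 (1 - (\<Sum>k<n. x k)) / real n) / max 1 (\<Sum>k<n. x k)"

lemma normalize_weights_nonneg: "0 \<le> x j \<Longrightarrow> 0 \<le> normalize_weights n x j"
  by (auto simp: normalize_weights_def intro!: divide_nonneg_pos add_nonneg_nonneg)

lemma sum_normalize_weights:
  assumes "0 < n"
  shows "(\<Sum>j<n. normalize_weights n x j) = 1"
proof -
  have "(\<Sum>j<n. normalize_weights n x j) =
      ((\<Sum>j<n. x j) + max 0 (1 - (\<Sum>k<n. x k))) / max 1 (\<Sum>k<n. x k)"
    using assms by (simp add: normalize_weights_def sum.distrib flip: sum_divide_distrib)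
  \<comment> \<open>If the total is at most 1, numerator and denominator are both 1; otherwise both
    equal the total.\<close>
  then show ?thesis by (auto simp: max_def)
qed

lemma normalize_weights_eq: "(\<Sum>k<n. x k) = 1 \<Longrightarrow> normalize_weights n x j = x j"
  by (simp add: normalize_weights_def)

lemma continuous_on_normalize_weights: "continuous_on A (\<lambda>x. normalize_weights n x j)"
proof -
  have c: "continuous_on A (\<lambda>x::nat \<Rightarrow> real. x k)" for k
    by (rule continuous_on_subset[OF continuous_on_product_coordinates]) simp
  show ?thesis
    unfolding normalize_weights_def divide_inverse
    by (intro continuous_intros c) (simp add: max_def)
qed

text \<open>The fixed points of the Nash map \<open>T\<close>, which shifts weight towards the points
  \<open>p j\<close> with \<open>\<phi> x (p j) > 0\<close>, are the solutions.\<close>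

lemma ky_fan_finite:
  fixes W :: "'v::real_vector topology" and \<phi> :: "'v \<Rightarrow> 'v \<Rightarrow> real" and p :: "nat \<Rightarrow> 'v"
  assumes top: "topspace W = UNIV"
    and add: "continuous_map (prod_topology W W) W (\<lambda>(x, y). x + y)"
    and scale: "continuous_map (prod_topology euclideanreal W) W (\<lambda>(c, x). c *\<^sub>R x)"
    and K: "convex K" and n: "0 < n" and p: "\<And>j. j < n \<Longrightarrow> p j \<in> K"
    and cont: "\<And>y. y \<in> K \<Longrightarrow> continuous_map (subtopology W K) euclideanreal (\<lambda>x. \<phi> x y)"
    and concave: "\<And>x. x \<in> K \<Longrightarrow> concave_on K (\<phi> x)"
    and diag: "\<And>x. x \<in> K \<Longrightarrow> \<phi> x x \<le> 0"
  shows "\<exists>x\<in>K. \<forall>j<n. \<phi> x (p j) \<le> 0"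
proof -
  let ?w = "normalize_weights n"
  define comb where "comb x = (\<Sum>j<n. x j *\<^sub>R p j)" for x :: "nat \<Rightarrow> real"
  \<comment> \<open>The weights are normalized first, so that \<open>g\<close> and \<open>T\<close>
    make sense on the whole cube, where Brouwer's theorem is available.\<close>
  define g where "g j x = max 0 (\<phi> (comb (?w x)) (p j))" for j x
  define T where "T x j = (if j < n then (?w x j + g j x) / (1 + (\<Sum>k<n. g k x)) else 0)" for x j
  have nonneg: "0 \<le> x j" if "x \<in> fun_cube n" for x j
    using that by (simp add: fun_cube_def)
  have g0: "0 \<le> g j x" for j x by (simp add: g_def)
  have S0: "0 \<le> (\<Sum>k<n. g k x)" for x by (simp add: sum_nonneg g0)
  have combK: "comb x \<in> K" if "\<And>j. j < n \<Longrightarrow> 0 \<le> x j" "(\<Sum>j<n. x j) = 1" for x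
    unfolding comb_def using that p by (intro convex_sum[OF _ K]) auto
  have wK: "comb (?w x) \<in> K" if "x \<in> fun_cube n" for x
    by (rule combK) (simp_all add: normalize_weights_nonneg nonneg[OF that] sum_normalize_weights n)
  have "continuous_map (top_of_set (fun_cube n)) W (\<lambda>x. comb (?w x))"
    unfolding comb_def
    by (rule continuous_map_linear_combination[OF top add scale])
      (simp_all add: continuous_on_normalize_weights)
  then have combc: "continuous_map (top_of_set (fun_cube n)) (subtopology W K) (\<lambda>x. comb (?w x))"
    by (rule continuous_map_into_subtopology) (auto simp: wK)
  have gc: "continuous_on (fun_cube n) (g j)" if "j < n" for j
  proof -
    have "continuous_on (fun_cube n) (\<lambda>x. \<phi> (comb (?w x)) (p j))"
      using continuous_map_compose[OF combc cont[OF p[OF that]]] by (simp add: o_def)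
    then show ?thesis
      unfolding g_def[abs_def] by (intro continuous_intros)
  qed
  have Tc: "continuous_on (fun_cube n) T"
  proof (rule continuous_on_coordinatewise_then_product)
    fix j
    show "continuous_on (fun_cube n) (\<lambda>x. T x j)"
    proof (cases "j < n")
      case True
      have "1 + (\<Sum>k<n. g k x) \<noteq> 0" for x
        using S0[of x] by linarith
      then have "continuous_on (fun_cube n) (\<lambda>x. (?w x j + g j x) / (1 + (\<Sum>k<n. g k x)))"
        using True by (intro continuous_on_divide continuous_on_add continuous_on_sum
            continuous_on_const continuous_on_normalize_weights gc) auto
      then show ?thesis
        using True by (simp add: T_def)
    qed (simp add: T_def)
  qed
  have "T x \<in> fun_cube n" if x: "x \<in> fun_cube n" for x
    unfolding fun_cube_def mem_Collect_eq
  proof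
    fix j
    show "0 \<le> T x j \<and> T x j \<le> (if j < n then 1 else 0)"
    proof (cases "j < n")
      case True
      have w0: "0 \<le> ?w x k" for k by (rule normalize_weights_nonneg[OF nonneg[OF x]])
      have "?w x j \<le> (\<Sum>k<n. ?w x k)"
        by (rule member_le_sum) (use True w0 in auto)
      moreover have "g j x \<le> (\<Sum>k<n. g k x)"
        by (rule member_le_sum) (use True g0 in auto)
      ultimately have "?w x j + g j x \<le> 1 + (\<Sum>k<n. g k x)"
        by (simp add: sum_normalize_weights n)
      then show ?thesis
        using True w0[of j] g0[of j x] S0[of x] by (simp add: T_def)
    qed (simp add: T_def)
  qed
  then obtain x where x: "x \<in> fun_cube n" and Tx: "T x = x"
    using brouwer_fun_cube[OF Tc] by blast
  define S where "S = (\<Sum>k<n. g k x)"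
  have S: "0 \<le> S" by (simp add: S_def S0)
  \<comment> \<open>The values of \<open>T\<close> have total weight 1, so its fixed point lies in
    the simplex and normalization leaves it unchanged.\<close>
  have "(\<Sum>j<n. x j) = (\<Sum>j<n. T x j)" by (simp add: Tx)
  also have "\<dots> = (\<Sum>j<n. (?w x j + g j x) / (1 + S))"
    by (simp add: T_def S_def)
  also have "\<dots> = 1"
    using S n by (simp add: sum.distrib sum_normalize_weights flip: sum_divide_distrib S_def)
  finally have sum1: "(\<Sum>j<n. x j) = 1" .
  have w: "?w x = x"
    using sum1 by (auto simp: normalize_weights_eq)
  define y where "y = comb x"
  have y: "y \<in> K" using wK[OF x] by (simp add: w y_def)
  have g: "g j x = max 0 (\<phi> y (p j))" for j by (simp add: g_def w y_def)
  have xg: "x j * S = g j x" if "j < n" for j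
  proof -
    have "x j = (x j + g j x) / (1 + S)"
      using fun_cong[OF Tx, of j] that by (simp add: T_def w S_def)
    then show ?thesis using S by (simp add: field_simps)
  qed
  \<comment> \<open>If \<open>S\<close> were positive, \<open>xg\<close> would give \<phi> y (p j) >
    0 at every \<open>p j\<close> of positive weight. As \<open>y\<close> is the weighted mean of
    the \<open>p j\<close>, concavity would make \<phi> y y positive.\<close>
  have "S = 0"
  proof (rule ccontr)
    assume "S \<noteq> 0"
    then have S: "0 < S" using S by simp
    have pos: "0 < \<phi> y (p j)" if "j < n" "x j \<noteq> 0" for j
    proof -
      have "0 < x j" using nonneg[OF x, of j] that by simp
      then have "0 < g j x" using xg[OF that(1)] S by (metis mult_pos_pos)
      then show ?thesis by (simp add: g)
    qed
    obtain k where k: "k < n" "x k \<noteq> 0"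
      using sum1 by (metis (no_types, lifting) lessThan_iff sum.neutral zero_neq_one)
    have "0 < (\<Sum>j<n. x j * \<phi> y (p j))"
    proof (rule sum_pos2[of _ k])
      show "0 < x k * \<phi> y (p k)"
        using pos[OF k] nonneg[OF x, of k] k by simp
      show "0 \<le> x j * \<phi> y (p j)" if "j \<in> {..<n}" for j
        using pos[of j] nonneg[OF x, of j] that by (cases "x j = 0") auto
    qed (use k in auto)
    also have "\<dots> \<le> \<phi> y y"
      using concave_on_sum[OF _ _ concave[OF y] sum1, of p] n p nonneg[OF x]
      by (auto simp: y_def comb_def)
    finally show False using diag[OF y] by simp
  qed
  then have "\<phi> y (p j) \<le> 0" if "j < n" for j
    using xg[OF that] by (simp add: g)
  then show ?thesis using y by blast
qed

text \<open>For each \<open>y\<close> the set of admissible \<open>x\<close> is closed in the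
  compact \<open>K\<close>, and finitely many of these sets meet by
  \<open>ky_fan_finite\<close>.\<close>

theorem ky_fan:
  fixes W :: "'v::real_vector topology" and \<phi> :: "'v \<Rightarrow> 'v \<Rightarrow> real"
  assumes top: "topspace W = UNIV"
    and add: "continuous_map (prod_topology W W) W (\<lambda>(x, y). x + y)"
    and scale: "continuous_map (prod_topology euclideanreal W) W (\<lambda>(c, x). c *\<^sub>R x)"
    and K: "convex K" "K \<noteq> {}" and compact: "compactin W K"
    and cont: "\<And>y. y \<in> K \<Longrightarrow> continuous_map (subtopology W K) euclideanreal (\<lambda>x. \<phi> x y)"
    and concave: "\<And>x. x \<in> K \<Longrightarrow> concave_on K (\<phi> x)"
    and diag: "\<And>x. x \<in> K \<Longrightarrow> \<phi> x x \<le> 0"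
  shows "\<exists>x\<in>K. \<forall>y\<in>K. \<phi> x y \<le> 0"
proof -
  define D where "D y = {x \<in> K. \<phi> x y \<le> 0}" for y
  have "compact_space (subtopology W K)"
    using compact by (simp add: compact_space_subtopology)
  moreover have "closedin (subtopology W K) (D y)" if "y \<in> K" for y
    using closedin_continuous_map_preimage[OF cont[OF that], of "{..0}"] by (simp add: D_def top)
  moreover have "\<Inter>\<F> \<noteq> {}" if fin: "finite \<F>" and sub: "\<F> \<subseteq> D ` K" for \<F>
  \<comment> \<open>The empty family intersects in \<open>UNIV\<close>, so only non-empty families
    require an argument.\<close>
  proof (cases "\<F> = {}")
    case False
    obtain F where F: "finite F" "F \<subseteq> K" "\<F> = D ` F"
      using finite_subset_image[OF fin sub] by blast
    obtain p :: "nat \<Rightarrow> 'v" where p: "bij_betw p {..<card F} F"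
      using ex_bij_betw_nat_finite[OF F(1)] by (auto simp: atLeast0LessThan)
    have pF: "F = p ` {..<card F}" using p by (simp add: bij_betw_def)
    have "0 < card F" using F False by (auto simp: card_gt_0_iff)
    then have "\<exists>x\<in>K. \<forall>j<card F. \<phi> x (p j) \<le> 0"
      using pF F(2) by (intro ky_fan_finite[OF top add scale K(1) _ _ cont concave diag]) auto
    then obtain x where "x \<in> K" "\<And>y. y \<in> F \<Longrightarrow> \<phi> x y \<le> 0"
      using pF by (metis imageE lessThan_iff)
    then show ?thesis using F by (auto simp: D_def)
  qed simp
  ultimately have "\<Inter>(D ` K) \<noteq> {}"
    unfolding compact_space_fip by blast
  \<comment> \<open>Since \<open>K\<close> is non-empty, the common point lies in at least one
    \<open>D y\<close>, hence in \<open>K\<close>.\<close>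
  then show ?thesis using K(2) by (auto simp: D_def)
qed

section \<open>Perfection\<close>

lemma continuous_map_profile_update:
  assumes "i \<in> players G"
    and f: "continuous_map X (profile_top G) f"
    and g: "continuous_map X (strategy_top G i) g"
  shows "continuous_map X (profile_top G) (\<lambda>x. (f x)(i := g x))"
  unfolding profile_top_def continuous_map_componentwise
proof (intro conjI ballI)
  have "f ` topspace X \<subseteq> extensional (players G)"
    using f by (auto simp: profile_top_def continuous_map_componentwise)
  then show "(\<lambda>x. (f x)(i := g x)) ` topspace X \<subseteq> extensional (players G)"
    using assms(1) by (auto simp: extensional_def image_subset_iff)
next
  fix k assume "k \<in> players G"
  then have "continuous_map X (strategy_top G k) (\<lambda>x. f x k)"
    using f by (auto simp: profile_top_def continuous_map_componentwise)
  then show "continuous_map X (strategy_top G k) (\<lambda>x. ((f x)(i := g x)) k)"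
    using g by (cases "k = i") auto
qed

lemma continuous_map_profile_component:
  assumes "i \<in> players G" "continuous_map X (profile_top G) f"
  shows "continuous_map X (strategy_top G i) (\<lambda>x. f x i)"
  using assms by (auto simp: profile_top_def continuous_map_componentwise)

lemma profile_update:
  assumes "\<sigma> \<in> profiles G" "i \<in> players G" "\<mu> \<in> strategies G i"
  shows "\<sigma>(i := \<mu>) \<in> profiles G"
  using assms by (auto simp: profiles_def PiE_iff extensional_def)

text \<open>Charges are non-negative, so an event that is positive under one component of positive
  weight stays positive under the mixture.\<close>

lemma profile_carrier_mix:
  assumes G: "strategic_form_game G" and \<sigma>: "\<sigma> \<in> profiles G" and \<tau>: "\<tau> \<in> profiles G"
    and t: "0 \<le> t" "t \<le> 1"
  shows "t < 1 \<Longrightarrow> profile_carrier G \<sigma> \<subseteq> profile_carrier G (mix_profile G t \<sigma> \<tau>)"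
    and "0 < t \<Longrightarrow> profile_carrier G \<tau> \<subseteq> profile_carrier G (mix_profile G t \<sigma> \<tau>)"
proof -
  have nonneg: "0 \<le> \<rho> i E" if "\<rho> \<in> profiles G" "i \<in> players G" "E \<in> action_field G i" for \<rho> i E
    using G that unfolding strategic_form_game_def profiles_def PiE_iff charges_def by blast
  show "profile_carrier G \<sigma> \<subseteq> profile_carrier G (mix_profile G t \<sigma> \<tau>)" if "t < 1"
    unfolding profile_carrier_def
  proof (rule PiE_mono, rule subsetI)
    fix i E assume i: "i \<in> players G" and E: "E \<in> strategy_carrier G i (\<sigma> i)"
    then have "0 \<le> \<tau> i E" "0 < \<sigma> i E"
      using nonneg[OF \<tau>] by (auto simp: strategy_carrier_def)
    then have "0 < (1 - t) * \<sigma> i E + t * \<tau> i E"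
      using t that by (intro add_pos_nonneg) auto
    then show "E \<in> strategy_carrier G i (mix_profile G t \<sigma> \<tau> i)"
      using i E by (simp add: strategy_carrier_def mix_profile_def mix_def)
  qed
  show "profile_carrier G \<tau> \<subseteq> profile_carrier G (mix_profile G t \<sigma> \<tau>)" if "0 < t"
    unfolding profile_carrier_def
  proof (rule PiE_mono, rule subsetI)
    fix i E assume i: "i \<in> players G" and E: "E \<in> strategy_carrier G i (\<tau> i)"
    then have "0 \<le> \<sigma> i E" "0 < \<tau> i E"
      using nonneg[OF \<sigma>] by (auto simp: strategy_carrier_def)
    then have "0 < (1 - t) * \<sigma> i E + t * \<tau> i E"
      using t that by (intro add_nonneg_pos) auto
    then show "E \<in> strategy_carrier G i (mix_profile G t \<sigma> \<tau> i)"
      using i E by (simp add: strategy_carrier_def mix_profile_def mix_def)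
  qed
qed

text \<open>A profile is perfect iff it belongs to \<open>perfect_against G F\<close> for all finite \<open>F\<close>;
  this eliminates the nets.\<close>

definition perfect_against :: "'a game \<Rightarrow> 'a profile set \<Rightarrow> 'a profile set" where
  "perfect_against G F =
     {\<sigma> \<in> profiles G. \<forall>V. openin (profile_top G) V \<and> \<sigma> \<in> V \<longrightarrow>
        (\<exists>s\<in>V. \<exists>k\<in>V. best_response G k s \<and>
           (\<forall>\<rho>\<in>F. profile_carrier G \<rho> \<subseteq> profile_carrier G s))}"

section \<open>Perfection without nets\<close>

lemma perfect_against_mono:
  assumes "F \<subseteq> F'"
  shows "perfect_against G F' \<subseteq> perfect_against G F"
proof
  fix \<sigma> assume \<sigma>: "\<sigma> \<in> perfect_against G F'"
  have "\<exists>s\<in>V. \<exists>k\<in>V. best_response G k s \<and> (\<forall>\<rho>\<in>F. profile_carrier G \<rho> \<subseteq> profile_carrier G s)"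
    if V: "openin (profile_top G) V \<and> \<sigma> \<in> V" for V
  proof -
    have "\<exists>s\<in>V. \<exists>k\<in>V. best_response G k s \<and> (\<forall>\<rho>\<in>F'. profile_carrier G \<rho> \<subseteq> profile_carrier G s)"
      using \<sigma> V by (simp add: perfect_against_def)
    then obtain s k where sk: "s \<in> V" "k \<in> V" "best_response G k s"
      "\<forall>\<rho>\<in>F'. profile_carrier G \<rho> \<subseteq> profile_carrier G s"
      by (elim bexE conjE)
    show ?thesis
    proof (rule bexI[OF _ sk(1)], rule bexI[OF _ sk(2)], intro conjI ballI sk(3))
      fix \<rho> assume "\<rho> \<in> F"
      with assms have "\<rho> \<in> F'" ..
      with sk(4) show "profile_carrier G \<rho> \<subseteq> profile_carrier G s" ..
    qed
  qed
  then show "\<sigma> \<in> perfect_against G F"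
    using \<sigma> by (simp add: perfect_against_def)
qed

text \<open>An open \<open>V\<close> that refutes membership of one of its points refutes membership
  of all of them, so the complement is open.\<close>

lemma closedin_perfect_against: "closedin (profile_top G) (perfect_against G F)"
  unfolding closedin_def topspace_profile_top
proof
  show "perfect_against G F \<subseteq> profiles G" by (auto simp: perfect_against_def)
  show "openin (profile_top G) (profiles G - perfect_against G F)"
  proof (subst openin_subopen, intro ballI)
    fix \<sigma> assume \<sigma>: "\<sigma> \<in> profiles G - perfect_against G F"
    then obtain V where V: "openin (profile_top G) V" "\<sigma> \<in> V" and
      no: "\<not> (\<exists>s\<in>V. \<exists>k\<in>V. best_response G k s \<and>
           (\<forall>\<rho>\<in>F. profile_carrier G \<rho> \<subseteq> profile_carrier G s))"
      by (auto simp: perfect_against_def)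
    have "V \<subseteq> profiles G - perfect_against G F"
    proof
      fix \<tau> assume \<tau>: "\<tau> \<in> V"
      then have "\<tau> \<notin> perfect_against G F"
        using V(1) no unfolding perfect_against_def by blast
      then show "\<tau> \<in> profiles G - perfect_against G F"
        using openin_subset[OF V(1)] \<tau> by (auto simp: topspace_profile_top)
    qed
    then show "\<exists>T. openin (profile_top G) T \<and> \<sigma> \<in> T \<and> T \<subseteq> profiles G - perfect_against G F"
      using V by blast
  qed
qed

text \<open>Far enough along the net, the finitely many carriers are contained simultaneously and
  both nets lie in \<open>V\<close>; a single index supplies \<open>s\<close> and
  \<open>k\<close>.\<close>

lemma perfect_imp_perfect_against:
  assumes "perfect G \<sigma>" "finite F" "F \<subseteq> profiles G"
  shows "\<sigma> \<in> perfect_against G F"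
proof -
  obtain I :: "('a profile set \<times> 'a profile set \<times> nat) set" and le s k
    where \<sigma>: "\<sigma> \<in> profiles G" and I: "directed_set I le"
    and cm: "completely_mixed G I le s"
    and cs: "net_converges (profile_top G) I le s \<sigma>"
    and ck: "net_converges (profile_top G) I le k \<sigma>"
    and br: "\<forall>\<alpha>\<in>I. best_response G (k \<alpha>) (s \<alpha>)"
    using assms(1) unfolding perfect_def perfect_along_def by blast
  have "\<exists>s\<in>V. \<exists>k\<in>V. best_response G k s \<and> (\<forall>\<rho>\<in>F. profile_carrier G \<rho> \<subseteq> profile_carrier G s)"
    if V: "openin (profile_top G) V" "\<sigma> \<in> V" for V
  proof -
    have "\<exists>\<alpha>\<in>I. \<forall>\<beta>\<in>I. le \<alpha> \<beta> \<longrightarrow> (\<forall>\<rho>\<in>F. profile_carrier G \<rho> \<subseteq> profile_carrier G (s \<beta>))"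
    proof (rule directed_set_eventually_finite[OF I assms(2)], rule ballI)
      fix \<rho> assume "\<rho> \<in> F"
      then have "is_carrier G (profile_carrier G \<rho>)"
        using assms(3) by (auto simp: is_carrier_def)
      then show "\<exists>\<alpha>\<in>I. \<forall>\<beta>\<in>I. le \<alpha> \<beta> \<longrightarrow> profile_carrier G \<rho> \<subseteq> profile_carrier G (s \<beta>)"
        using cm unfolding completely_mixed_def by blast
    qed
    then obtain a where a: "a \<in> I"
      "\<And>\<beta>. \<beta> \<in> I \<Longrightarrow> le a \<beta> \<Longrightarrow> \<forall>\<rho>\<in>F. profile_carrier G \<rho> \<subseteq> profile_carrier G (s \<beta>)"
      by blast
    obtain b where b: "b \<in> I" "\<And>\<beta>. \<beta> \<in> I \<Longrightarrow> le b \<beta> \<Longrightarrow> s \<beta> \<in> V"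
      using cs V unfolding net_converges_def by blast
    obtain c where c: "c \<in> I" "\<And>\<beta>. \<beta> \<in> I \<Longrightarrow> le c \<beta> \<Longrightarrow> k \<beta> \<in> V"
      using ck V unfolding net_converges_def by blast
    obtain d where d: "d \<in> I" "le a d" "le b d"
      using directed_set_upper_bound[OF I a(1) b(1)] .
    obtain d' where d': "d' \<in> I" "le d d'" "le c d'"
      using directed_set_upper_bound[OF I d(1) c(1)] .
    have ad: "le a d'" and bd: "le b d'"
      using directed_set_trans[OF I a(1) d(1) d'(1) d(2) d'(2)]
        directed_set_trans[OF I b(1) d(1) d'(1) d(3) d'(2)] .
    show ?thesis
      by (rule bexI[OF _ b(2)[OF d'(1) bd]], rule bexI[OF _ c(2)[OF d'(1) d'(3)]],
          intro conjI a(2)[OF d'(1) ad] bspec[OF br d'(1)])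
  qed
  then show ?thesis
    unfolding perfect_against_def mem_Collect_eq by (intro conjI \<sigma> allI impI) (erule conjE)
qed

text \<open>The nets are indexed by finite sets of profiles and neighbourhoods of \<sigma>, ordered
  by growing sets and shrinking neighbourhoods. Growing sets make the net completely mixed,
  shrinking neighbourhoods make it converge.\<close>

lemma perfect_against_imp_perfect:
  assumes \<sigma>: "\<And>F. finite F \<Longrightarrow> F \<subseteq> profiles G \<Longrightarrow> \<sigma> \<in> perfect_against G F"
  shows "perfect G \<sigma>"
proof -
  have \<sigma>P: "\<sigma> \<in> profiles G"
    using \<sigma>[of "{}"] by (simp add: perfect_against_def)
  \<comment> \<open>The natural number provides a strictly larger index above each index, as a
    directed set must have no maximal element.\<close>
  define I :: "('a profile set \<times> 'a profile set \<times> nat) set"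
    where "I = {F. finite F \<and> F \<subseteq> profiles G} \<times> {V. openin (profile_top G) V \<and> \<sigma> \<in> V} \<times> UNIV"
  define le :: "'a profile set \<times> 'a profile set \<times> nat \<Rightarrow> _ \<Rightarrow> bool"
    where "le x y \<longleftrightarrow> fst x \<subseteq> fst y \<and> fst (snd y) \<subseteq> fst (snd x) \<and> snd (snd x) \<le> snd (snd y)" for x y
  have top: "openin (profile_top G) (profiles G)"
    using openin_topspace[of "profile_top G"] by (simp add: topspace_profile_top)
  have I: "directed_set I le"
    unfolding directed_set_def
  proof (intro conjI ballI impI)
    show "I \<noteq> {}"
      using top \<sigma>P by (auto simp: I_def)
  next
    fix x y assume xy: "x \<in> I" "y \<in> I"
    let ?z = "(fst x \<union> fst y, fst (snd x) \<inter> fst (snd y), max (snd (snd x)) (snd (snd y)))"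
    have "?z \<in> I" using xy by (auto simp: I_def)
    then show "\<exists>z\<in>I. le x z \<and> le y z"
      by (rule bexI[rotated]) (auto simp: le_def)
  next
    fix x assume x: "x \<in> I"
    let ?y = "(fst x, fst (snd x), Suc (snd (snd x)))"
    have "?y \<in> I" using x by (auto simp: I_def)
    then show "\<exists>y\<in>I. le x y \<and> y \<noteq> x"
      by (rule bexI[rotated]) (auto simp: le_def prod_eq_iff)
  next
    fix x show "le x x" by (simp add: le_def)
  next
    fix x y z assume "le x y" "le y z"
    then show "le x z" unfolding le_def by (meson order_trans)
  qed
  have "\<exists>s k. s \<in> fst (snd x) \<and> k \<in> fst (snd x) \<and> best_response G k s \<and>
      (\<forall>\<rho>\<in>fst x. profile_carrier G \<rho> \<subseteq> profile_carrier G s)" if "x \<in> I" for x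
  proof -
    have x: "finite (fst x)" "fst x \<subseteq> profiles G" "openin (profile_top G) (fst (snd x)) \<and> \<sigma> \<in> fst (snd x)"
      using that by (auto simp: I_def)
    show ?thesis
      using \<sigma>[OF x(1,2)] x(3) unfolding perfect_against_def by blast
  qed
  then have "\<forall>x\<in>I. \<exists>z. fst z \<in> fst (snd x) \<and> snd z \<in> fst (snd x) \<and> best_response G (snd z) (fst z) \<and>
      (\<forall>\<rho>\<in>fst x. profile_carrier G \<rho> \<subseteq> profile_carrier G (fst z))"
    by simp
  then obtain z where z: "\<forall>x\<in>I. fst (z x) \<in> fst (snd x) \<and> snd (z x) \<in> fst (snd x) \<and>
      best_response G (snd (z x)) (fst (z x)) \<and>
      (\<forall>\<rho>\<in>fst x. profile_carrier G \<rho> \<subseteq> profile_carrier G (fst (z x)))"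
    by (rule exE[OF bchoice])
  define s k where "s x = fst (z x)" and "k x = snd (z x)" for x
  have sk: "s x \<in> fst (snd x)" "k x \<in> fst (snd x)" "best_response G (k x) (s x)"
      "\<And>\<rho>. \<rho> \<in> fst x \<Longrightarrow> profile_carrier G \<rho> \<subseteq> profile_carrier G (s x)" if "x \<in> I" for x
    using bspec[OF z that] by (simp_all add: s_def k_def)
  have V: "fst (snd x) \<subseteq> profiles G" if "x \<in> I" for x
    unfolding topspace_profile_top[symmetric] by (rule openin_subset) (use that in \<open>auto simp: I_def\<close>)
  have conv: "net_converges (profile_top G) I le h \<sigma>" if h: "\<And>x. x \<in> I \<Longrightarrow> h x \<in> fst (snd x)" for h
    unfolding net_converges_def topspace_profile_top
  proof (intro conjI allI impI \<sigma>P)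
    fix V assume "openin (profile_top G) V \<and> \<sigma> \<in> V"
    then have "({}, V, 0) \<in> I" by (auto simp: I_def)
    then show "\<exists>x\<in>I. \<forall>y\<in>I. le x y \<longrightarrow> h y \<in> V"
      using h by (intro bexI[of _ "({}, V, 0)"]) (auto simp: le_def)
  qed
  have "completely_mixed G I le s"
    unfolding completely_mixed_def
  proof (intro allI impI)
    fix C assume "is_carrier G C"
    then obtain \<rho> where \<rho>: "\<rho> \<in> profiles G" "C = profile_carrier G \<rho>"
      by (auto simp: is_carrier_def)
    then have "({\<rho>}, profiles G, 0) \<in> I" using \<sigma>P top by (auto simp: I_def)
    moreover have "C \<subseteq> profile_carrier G (s y)" if "y \<in> I" "le ({\<rho>}, profiles G, 0) y" for y
      using sk(4)[OF that(1), of \<rho>] that(2) by (simp add: \<rho>(2) le_def)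
    ultimately show "\<exists>x\<in>I. \<forall>y\<in>I. le x y \<longrightarrow> C \<subseteq> profile_carrier G (s y)"
      by blast
  qed
  then have "perfect_along G I le \<sigma>"
    unfolding perfect_along_def
  proof (intro conjI exI ballI)
    show "net_converges (profile_top G) I le s \<sigma>" "net_converges (profile_top G) I le k \<sigma>"
      by (rule conv, erule sk)+
    show "s x \<in> profiles G" "k x \<in> profiles G" "best_response G (k x) (s x)" if "x \<in> I" for x
      using sk[OF that] V[OF that] by auto
  qed (simp_all add: \<sigma>P I)
  then show ?thesis unfolding perfect_def by blast
qed

text \<open>A strictly profitable deviation at \<sigma> would by continuity remain profitable for
  all \<open>s\<close> and \<open>k\<close> near \<sigma>, although some such \<open>k\<close> is a
  best response to \<open>s\<close>.\<close>

lemma perfect_imp_nash_equilibrium: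
  assumes cont: "\<And>i. i \<in> players G \<Longrightarrow> continuous_payoff G i" and "perfect G \<sigma>"
  shows "nash_equilibrium G \<sigma>"
proof -
  let ?P = "profile_top G"
  have \<sigma>: "\<sigma> \<in> perfect_against G {}"
    by (rule perfect_imp_perfect_against[OF assms(2)]) auto
  then have \<sigma>P: "\<sigma> \<in> profiles G" by (simp add: perfect_against_def)
  have "payoff G i (\<sigma>(i := \<nu>)) \<le> payoff G i \<sigma>" if i: "i \<in> players G" and \<nu>: "\<nu> \<in> strategies G i" for i \<nu>
  proof (rule ccontr)
    assume less: "\<not> ?thesis"
    \<comment> \<open>For \<open>z = (s, k)\<close> this is the gain against \<open>s\<close> from
      playing \<nu> instead of \<open>k i\<close>; at (\<sigma>, \<sigma>) it is the gain from
      deviating at \<sigma>.\<close>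
    define h where "h z = payoff G i ((fst z)(i := \<nu>)) - payoff G i ((fst z)(i := snd z i))" for z
    have U: "continuous_map ?P euclideanreal (payoff G i)"
      using cont[OF i] by (simp add: continuous_payoff_def)
    have "continuous_map (prod_topology ?P ?P) ?P (\<lambda>z. (fst z)(i := \<nu>))"
      using \<nu> by (intro continuous_map_profile_update[OF i] continuous_map_fst)
        (simp add: strategies_def)
    moreover have "continuous_map (prod_topology ?P ?P) ?P (\<lambda>z. (fst z)(i := snd z i))"
      by (intro continuous_map_profile_update[OF i] continuous_map_profile_component[OF i]
          continuous_map_fst continuous_map_snd)
    ultimately have "continuous_map (prod_topology ?P ?P) euclideanreal h"
      unfolding h_def[abs_def]
      by (intro continuous_map_diff continuous_map_compose[OF _ U, unfolded o_def])
    then have "openin (prod_topology ?P ?P) {z \<in> topspace (prod_topology ?P ?P). h z \<in> {0<..}}"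
      by (rule openin_continuous_map_preimage) auto
    moreover have "(\<sigma>, \<sigma>) \<in> {z \<in> topspace (prod_topology ?P ?P). h z \<in> {0<..}}"
      using less \<sigma>P by (simp add: h_def topspace_profile_top)
    ultimately have "\<exists>A B. openin ?P A \<and> openin ?P B \<and> \<sigma> \<in> A \<and> \<sigma> \<in> B \<and>
        A \<times> B \<subseteq> {z \<in> topspace (prod_topology ?P ?P). h z \<in> {0<..}}"
      by (simp only: openin_prod_topology_alt)
    then obtain A B where AB: "openin ?P A" "openin ?P B" "\<sigma> \<in> A" "\<sigma> \<in> B"
        "A \<times> B \<subseteq> {z \<in> topspace (prod_topology ?P ?P). h z \<in> {0<..}}"
      by (elim exE conjE)
    have "openin ?P (A \<inter> B) \<and> \<sigma> \<in> A \<inter> B"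
      using openin_Int[OF AB(1,2)] AB(3,4) by simp
    then have "\<exists>s\<in>A \<inter> B. \<exists>k\<in>A \<inter> B. best_response G k s"
      using \<sigma> by (simp add: perfect_against_def)
    then obtain s k where sk: "s \<in> A" "k \<in> B" "best_response G k s"
      by (elim bexE IntE) (rule that)
    have "(s, k) \<in> A \<times> B" using sk by simp
    then have "0 < h (s, k)" using subsetD[OF AB(5)] by fastforce
    moreover have "h (s, k) \<le> 0"
      using sk(3) i \<nu> by (simp add: h_def best_response_def best_response_of_def)
    ultimately show False by simp
  qed
  then show ?thesis
    using \<sigma>P by (auto simp: nash_equilibrium_def best_response_def best_response_of_def
        profiles_def PiE_iff)
qed

section \<open>Existence and compactness\<close>

locale compact_convex_game =
  fixes G :: "'a game" and W :: "'v::real_vector topology" and e :: "'a profile \<Rightarrow> 'v"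
  assumes game: "strategic_form_game G"
    and tvs: "locally_convex_tvs W"
    and identifies: "identifies_profiles G W e"
    and compact: "compactin W (e ` profiles G)"
    and convex: "convex (e ` profiles G)"
    and multilinear: "\<And>i. i \<in> players G \<Longrightarrow> multilinear_payoff G i"
    and continuous: "\<And>i. i \<in> players G \<Longrightarrow> continuous_payoff G i"
begin

lemma tvs_top: "topspace W = UNIV"
  and tvs_add: "continuous_map (prod_topology W W) W (\<lambda>(x, y). x + y)"
  and tvs_scale: "continuous_map (prod_topology euclideanreal W) W (\<lambda>(c, x). c *\<^sub>R x)"
  using tvs by (simp_all add: locally_convex_tvs_def)

lemma homeomorphic: "homeomorphic_map (profile_top G) (subtopology W (e ` profiles G)) e"
  using identifies
  by (simp add: identifies_profiles_def embedding_map_def topspace_profile_top)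

text \<open>The inverse of \<open>e\<close> on its image, through which Ky Fan's inequality for
  vectors is applied to profiles.\<close>

definition decode :: "'v \<Rightarrow> 'a profile" where
  "decode = (SOME d. homeomorphic_maps (profile_top G) (subtopology W (e ` profiles G)) e d)"

lemma homeomorphic_decode:
  "homeomorphic_maps (profile_top G) (subtopology W (e ` profiles G)) e decode"
  unfolding decode_def
  by (rule someI_ex[OF homeomorphic[unfolded homeomorphic_map_maps]])

lemma continuous_map_encode: "continuous_map (profile_top G) W e"
  and continuous_map_decode: "continuous_map (subtopology W (e ` profiles G)) (profile_top G) decode"
  using homeomorphic_decode by (simp_all add: homeomorphic_maps_def continuous_map_in_subtopology)

lemma decode_encode: "\<sigma> \<in> profiles G \<Longrightarrow> decode (e \<sigma>) = \<sigma>"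
  using homeomorphic_decode by (simp add: homeomorphic_maps_def topspace_profile_top)

lemma compact_space_profiles: "compact_space (profile_top G)"
  using homeomorphic_compact_space[OF homeomorphic_map_imp_homeomorphic_space[OF homeomorphic]] compact
  by (simp add: compact_space_subtopology)

text \<open>Convexity of the image yields a profile encoded by the vector combination, and the
  identification forces it to be the setwise mixture.\<close>

lemma mix_profile_closed:
  assumes \<sigma>: "\<sigma> \<in> profiles G" and \<tau>: "\<tau> \<in> profiles G" and t: "t \<in> {0..1}"
  shows "mix_profile G t \<sigma> \<tau> \<in> profiles G"
    and "e (mix_profile G t \<sigma> \<tau>) = (1 - t) *\<^sub>R e \<sigma> + t *\<^sub>R e \<tau>"
proof -
  have "(1 - t) *\<^sub>R e \<sigma> + t *\<^sub>R e \<tau> \<in> e ` profiles G"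
    using convexD_alt[OF convex, of "e \<sigma>" "e \<tau>" t] \<sigma> \<tau> t by simp
  then obtain \<rho> where \<rho>: "\<rho> \<in> profiles G" "e \<rho> = (1 - t) *\<^sub>R e \<sigma> + t *\<^sub>R e \<tau>"
    by (metis imageE)
  moreover have "\<rho> = mix_profile G t \<sigma> \<tau>"
    using identifies \<sigma> \<tau> t \<rho> unfolding identifies_profiles_def by blast
  ultimately show "mix_profile G t \<sigma> \<tau> \<in> profiles G"
    and "e (mix_profile G t \<sigma> \<tau>) = (1 - t) *\<^sub>R e \<sigma> + t *\<^sub>R e \<tau>"
    by simp_all
qed

text \<open>The mixture is computed in the vector space, where the operations are continuous, and
  decoded. Continuity is joint in the weight and the profile because both vary when the perturbation
  vanishes.\<close>

lemma continuous_map_mix_profile: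
  assumes \<tau>: "\<tau> \<in> profiles G"
  shows "continuous_map (prod_topology (top_of_set {0..1}) (profile_top G)) (profile_top G)
    (\<lambda>z. mix_profile G (fst z) (snd z) \<tau>)"
proof -
  let ?X = "prod_topology (top_of_set {0..1::real}) (profile_top G)"
  let ?f = "\<lambda>z. (1 - fst z) *\<^sub>R e (snd z) + fst z *\<^sub>R e \<tau>"
  have fst: "continuous_map ?X euclideanreal fst"
    using continuous_map_fst continuous_map_into_fulltopology by blast
  have "continuous_map ?X (prod_topology euclideanreal W) (\<lambda>z. (1 - fst z, e (snd z)))"
    using continuous_map_compose[OF continuous_map_snd continuous_map_encode, of "top_of_set {0..1::real}"]
    by (intro continuous_map_pairedI continuous_map_diff fst) (simp_all add: o_def)
  from continuous_map_compose[OF this tvs_scale]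
  have 1: "continuous_map ?X W (\<lambda>z. (1 - fst z) *\<^sub>R e (snd z))" by (simp add: o_def)
  have "continuous_map ?X (prod_topology euclideanreal W) (\<lambda>z. (fst z, e \<tau>))"
    by (intro continuous_map_pairedI fst) (simp add: tvs_top)
  from continuous_map_compose[OF this tvs_scale]
  have 2: "continuous_map ?X W (\<lambda>z. fst z *\<^sub>R e \<tau>)" by (simp add: o_def)
  from continuous_map_compose[OF continuous_map_pairedI[OF 1 2] tvs_add]
  have "continuous_map ?X W ?f" by (simp add: o_def)
  moreover have f: "?f z = e (mix_profile G (fst z) (snd z) \<tau>)"
    and mem: "mix_profile G (fst z) (snd z) \<tau> \<in> profiles G" if "z \<in> topspace ?X" for z
    using that mix_profile_closed[of "snd z" \<tau> "fst z"] \<tau>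
    by (simp_all add: mem_Times_iff topspace_profile_top)
  ultimately have "continuous_map ?X (subtopology W (e ` profiles G)) ?f"
    by (intro continuous_map_into_subtopology) simp_all
  from continuous_map_compose[OF this continuous_map_decode] show ?thesis
    by (rule continuous_map_eq) (simp only: o_apply f decode_encode[OF mem])
qed

lemma continuous_map_mix_profile_left:
  assumes \<tau>: "\<tau> \<in> profiles G" and t: "t \<in> {0..1}"
  shows "continuous_map (profile_top G) (profile_top G) (\<lambda>\<sigma>. mix_profile G t \<sigma> \<tau>)"
proof -
  have "continuous_map (profile_top G) (prod_topology (top_of_set {0..1}) (profile_top G)) (\<lambda>\<sigma>. (t, \<sigma>))"
    using t by (intro continuous_map_pairedI) simp_all
  from continuous_map_compose[OF this continuous_map_mix_profile[OF \<tau>]] show ?thesis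
    by (simp add: o_def)
qed

section \<open>Equilibria of perturbed games\<close>

lemma payoff_update_mix_profile:
  assumes i: "i \<in> players G" and s: "s \<in> profiles G"
    and \<rho>: "\<rho> \<in> profiles G" "\<rho>' \<in> profiles G" and t: "t \<in> {0..1}"
  shows "payoff G i (s(i := mix_profile G t \<rho> \<rho>' i)) =
    (1 - t) * payoff G i (s(i := \<rho> i)) + t * payoff G i (s(i := \<rho>' i))"
proof -
  have eq: "mix_profile G t \<rho> \<rho>' i = mix t (\<rho> i) (\<rho>' i)"
    using i by (simp add: mix_profile_def)
  have strat: "\<eta> i \<in> strategies G i" if "\<eta> \<in> profiles G" for \<eta>
    using that i unfolding profiles_def by (rule PiE_mem)
  \<comment> \<open>Multilinearity is only assumed for mixtures that are strategies; this one is a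
    component of a mixed profile.\<close>
  have mem: "mix t (\<rho> i) (\<rho>' i) \<in> strategies G i"
    using strat[OF mix_profile_closed(1)[OF \<rho> t]] by (simp add: eq)
  show ?thesis
    using multilinear[OF i, unfolded multilinear_payoff_def, rule_format,
        OF s i strat[OF \<rho>(1)] strat[OF \<rho>(2)] t mem]
    by (simp add: eq)
qed

text \<open>Ky Fan's inequality is applied to the total gain \<open>\<phi> \<kappa> \<rho>\<close> of the players who deviate
  one by one from \<open>\<kappa>\<close> to \<open>\<rho>\<close>, evaluated against the perturbation of \<open>\<kappa>\<close>.\<close>

lemma exists_best_response_to_perturbation:
  assumes \<tau>: "\<tau> \<in> profiles G" and t: "t \<in> {0..1}"
  shows "\<exists>\<kappa>\<in>profiles G. best_response G \<kappa> (mix_profile G t \<kappa> \<tau>)"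
proof -
  define s where "s \<kappa> = mix_profile G t \<kappa> \<tau>" for \<kappa>
  define gain where "gain i \<kappa> \<rho> = payoff G i ((s \<kappa>)(i := \<rho> i)) - payoff G i ((s \<kappa>)(i := \<kappa> i))"
    for i and \<kappa> \<rho> :: "'a profile"
  define \<phi> where "\<phi> \<kappa> \<rho> = (\<Sum>i\<in>players G. gain i \<kappa> \<rho>)" for \<kappa> \<rho>
  have fin: "finite (players G)" by (simp add: players_def)
  have s: "s \<kappa> \<in> profiles G" if "\<kappa> \<in> profiles G" for \<kappa>
    unfolding s_def by (rule mix_profile_closed(1)[OF that \<tau> t])
  have sc: "continuous_map (profile_top G) (profile_top G) s"
    unfolding s_def[abs_def] by (rule continuous_map_mix_profile_left[OF \<tau> t])
  have gainc: "continuous_map (profile_top G) euclideanreal (\<lambda>\<kappa>. gain i \<kappa> \<rho>)"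
    if i: "i \<in> players G" and \<rho>: "\<rho> \<in> profiles G" for i \<rho>
  proof -
    have U: "continuous_map (profile_top G) euclideanreal (payoff G i)"
      using continuous[OF i] by (simp add: continuous_payoff_def)
    have "\<rho> i \<in> topspace (strategy_top G i)"
      using \<rho> i unfolding profiles_def strategies_def by (rule PiE_mem)
    then have "continuous_map (profile_top G) (strategy_top G i) (\<lambda>\<kappa>. \<rho> i)"
      by simp
    note updates = continuous_map_profile_update[OF i sc this] continuous_map_profile_update[OF i sc
        continuous_map_profile_component[OF i continuous_map_id[unfolded id_def]]]
    show ?thesis
      unfolding gain_def
      by (intro continuous_map_diff continuous_map_compose[OF _ U, unfolded o_def] updates)
  qed
  have \<phi>c: "continuous_map (profile_top G) euclideanreal (\<lambda>\<kappa>. \<phi> \<kappa> \<rho>)" if "\<rho> \<in> profiles G" for \<rho>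
    unfolding \<phi>_def by (intro continuous_map_sum fin gainc that)
  \<comment> \<open>The perturbed profile depends on \<kappa> only, and each gain involves a single
    component of \<rho>, so multilinearity makes \<phi> affine in \<rho>; this yields concavity
    below.\<close>
  have \<phi>mix: "\<phi> \<kappa> (mix_profile G r \<rho> \<rho>') = (1 - r) * \<phi> \<kappa> \<rho> + r * \<phi> \<kappa> \<rho>'"
    if "\<kappa> \<in> profiles G" "\<rho> \<in> profiles G" "\<rho>' \<in> profiles G" "r \<in> {0..1}" for \<kappa> \<rho> \<rho>' r
  proof -
    have "gain i \<kappa> (mix_profile G r \<rho> \<rho>') = (1 - r) * gain i \<kappa> \<rho> + r * gain i \<kappa> \<rho>'"
      if i: "i \<in> players G" for i
      unfolding gain_def payoff_update_mix_profile[OF i s[OF \<open>\<kappa> \<in> profiles G\<close>] \<open>\<rho> \<in> profiles G\<close>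
          \<open>\<rho>' \<in> profiles G\<close> \<open>r \<in> {0..1}\<close>]
      by (simp add: algebra_simps)
    then show ?thesis
      by (simp add: \<phi>_def sum.distrib sum_distrib_left)
  qed
  have ne: "e ` profiles G \<noteq> {}" using \<tau> by auto
  have "\<exists>x\<in>e ` profiles G. \<forall>y\<in>e ` profiles G. \<phi> (decode x) (decode y) \<le> 0"
  proof (rule ky_fan[OF tvs_top tvs_add tvs_scale convex ne compact])
    fix y assume "y \<in> e ` profiles G"
    then have "decode y \<in> profiles G" by (auto simp: decode_encode)
    from continuous_map_compose[OF continuous_map_decode \<phi>c[OF this]]
    show "continuous_map (subtopology W (e ` profiles G)) euclideanreal (\<lambda>x. \<phi> (decode x) (decode y))"
      by (simp add: o_def)
  next
    fix x assume "x \<in> e ` profiles G"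
    then have x: "decode x \<in> profiles G" by (auto simp: decode_encode)
    show "concave_on (e ` profiles G) (\<lambda>y. \<phi> (decode x) (decode y))"
      unfolding concave_on_iff
    proof (intro conjI convex ballI allI impI)
      fix u v and a b :: real
      assume "u \<in> e ` profiles G" "v \<in> e ` profiles G" and ab: "0 \<le> a" "0 \<le> b" "a + b = 1"
      then obtain \<mu> \<nu> where \<mu>: "\<mu> \<in> profiles G" "u = e \<mu>" and \<nu>: "\<nu> \<in> profiles G" "v = e \<nu>"
        by (elim imageE)
      have a: "a = 1 - b" and b: "b \<in> {0..1}" using ab by auto
      have "decode (a *\<^sub>R u + b *\<^sub>R v) = mix_profile G b \<mu> \<nu>"
        using decode_encode[OF mix_profile_closed(1)[OF \<mu>(1) \<nu>(1) b]]
        by (simp add: mix_profile_closed(2)[OF \<mu>(1) \<nu>(1) b] a \<mu>(2) \<nu>(2))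
      then show "a * \<phi> (decode x) (decode u) + b * \<phi> (decode x) (decode v)
          \<le> \<phi> (decode x) (decode (a *\<^sub>R u + b *\<^sub>R v))"
        using \<phi>mix[OF x \<mu>(1) \<nu>(1) b] by (simp add: a \<mu> \<nu> decode_encode)
    qed
  next
    show "\<phi> (decode x) (decode x) \<le> 0" for x
      by (simp add: \<phi>_def gain_def)
  qed
  then obtain \<kappa> where \<kappa>: "\<kappa> \<in> profiles G" and le0: "\<And>\<rho>. \<rho> \<in> profiles G \<Longrightarrow> \<phi> \<kappa> \<rho> \<le> 0"
    by (auto simp: decode_encode)
  have "best_response_of G i (\<kappa> i) (s \<kappa>)" if i: "i \<in> players G" for i
    unfolding best_response_of_def
  proof (intro conjI ballI)
    show "\<kappa> i \<in> strategies G i"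
      using \<kappa> i unfolding profiles_def by (rule PiE_mem)
    fix \<nu> assume \<nu>: "\<nu> \<in> strategies G i"
    \<comment> \<open>When only player \<open>i\<close> deviates, all other gains vanish, so a bound
      on the total gain bounds that of each player.\<close>
    have "\<phi> \<kappa> (\<kappa>(i := \<nu>)) = (\<Sum>j\<in>players G. if j = i then gain i \<kappa> (\<kappa>(i := \<nu>)) else 0)"
      unfolding \<phi>_def by (rule sum.cong) (simp_all add: gain_def)
    also have "\<dots> = payoff G i ((s \<kappa>)(i := \<nu>)) - payoff G i ((s \<kappa>)(i := \<kappa> i))"
      using fin i by (simp add: gain_def)
    finally show "payoff G i ((s \<kappa>)(i := \<nu>)) \<le> payoff G i ((s \<kappa>)(i := \<kappa> i))"
      using le0[OF profile_update[OF \<kappa> i \<nu>]] by simp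
  qed
  then show ?thesis
    using \<kappa> by (auto simp: best_response_def s_def)
qed

section \<open>Vanishing perturbations\<close>

lemma profiles_nonempty: "profiles G \<noteq> {}"
  using game unfolding profiles_def PiE_eq_empty_iff strategic_form_game_def by blast

text \<open>An equal mixture contains the carriers of both its components; induction mixes in one
  profile at a time.\<close>

lemma exists_dominating_carrier:
  assumes "finite F" "F \<subseteq> profiles G"
  shows "\<exists>\<tau>\<in>profiles G. \<forall>\<rho>\<in>F. profile_carrier G \<rho> \<subseteq> profile_carrier G \<tau>"
  using assms
proof (induction F)
  case empty
  then show ?case using profiles_nonempty by blast
next
  case (insert \<rho> F)
  then obtain \<tau> where \<tau>: "\<tau> \<in> profiles G" "\<forall>\<rho>\<in>F. profile_carrier G \<rho> \<subseteq> profile_carrier G \<tau>"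
    by (metis insert_subset)
  have \<rho>: "\<rho> \<in> profiles G" using insert.prems by simp
  let ?m = "mix_profile G (1 / 2) \<rho> \<tau>"
  have "?m \<in> profiles G" using mix_profile_closed(1)[OF \<rho> \<tau>(1)] by simp
  moreover have "profile_carrier G \<rho> \<subseteq> profile_carrier G ?m" "profile_carrier G \<tau> \<subseteq> profile_carrier G ?m"
    using profile_carrier_mix[OF game \<rho> \<tau>(1), of "1 / 2"] by simp_all
  ultimately show ?case
    using \<tau>(2) by (intro bexI[of _ ?m]) (simp_all add: order_trans[of _ "profile_carrier G \<tau>"])
qed

text \<open>With perturbation weights tending to 0, a cluster point of the best responses \<kappa>
  is also approached by the perturbed profiles to which they respond, all of which dominate the
  carriers of \<open>F\<close>.\<close>

lemma perfect_against_nonempty: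
  assumes F: "finite F" "F \<subseteq> profiles G"
  shows "perfect_against G F \<noteq> {}"
proof -
  let ?P = "profile_top G" and ?T = "top_of_set {0..1::real}"
  obtain \<tau> where \<tau>: "\<tau> \<in> profiles G" and dom: "\<forall>\<rho>\<in>F. profile_carrier G \<rho> \<subseteq> profile_carrier G \<tau>"
    using exists_dominating_carrier[OF F] by (elim bexE)
  define t where "t m = 1 / real (Suc m)" for m
  have t: "t m \<in> {0..1}" "0 < t m" for m by (simp_all add: t_def)
  have "\<forall>m. \<exists>\<kappa>. \<kappa> \<in> profiles G \<and> best_response G \<kappa> (mix_profile G (t m) \<kappa> \<tau>)"
    using exists_best_response_to_perturbation[OF \<tau> t(1)] by (simp add: Bex_def)
  then obtain \<kappa> where \<kappa>: "\<forall>m. \<kappa> m \<in> profiles G \<and> best_response G (\<kappa> m) (mix_profile G (t m) (\<kappa> m) \<tau>)"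
    by (rule exE[OF choice])
  \<comment> \<open>The profile space is only known to be compact, so a cluster point common to the
    closures of all tails replaces a convergent subsequence.\<close>
  define C where "C m = ?P closure_of (\<kappa> ` {m..})" for m
  have "(\<Inter>m. C m) \<noteq> {}"
  proof (rule compact_space_imp_nest[OF compact_space_profiles])
    show "closedin ?P (C m)" for m by (simp add: C_def)
    show "C m \<noteq> {}" for m
      using closure_of_subset[of "\<kappa> ` {m..}" ?P] \<kappa> by (auto simp: C_def topspace_profile_top)
    show "decseq C"
      unfolding C_def by (intro antimonoI closure_of_mono image_mono) simp
  qed
  then obtain \<sigma> where \<sigma>: "\<And>m. \<sigma> \<in> C m" by blast
  have \<sigma>P: "\<sigma> \<in> profiles G"
    using \<sigma>[of 0] closure_of_subset_topspace[of ?P] by (auto simp: C_def topspace_profile_top)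
  have "\<exists>s\<in>V. \<exists>k\<in>V. best_response G k s \<and> (\<forall>\<rho>\<in>F. profile_carrier G \<rho> \<subseteq> profile_carrier G s)"
    if V: "openin ?P V" "\<sigma> \<in> V" for V
  proof -
    let ?Q = "{z \<in> topspace (prod_topology ?T ?P). mix_profile G (fst z) (snd z) \<tau> \<in> V}"
    have "openin (prod_topology ?T ?P) ?Q"
      by (rule openin_continuous_map_preimage[OF continuous_map_mix_profile[OF \<tau>] V(1)])
    \<comment> \<open>At weight 0 the mixture is \<sigma> itself, so joint continuity at (0,
      \<sigma>) gives a box that is mapped into \<open>V\<close>.\<close>
    moreover have "mix_profile G 0 \<sigma> \<tau> = \<sigma>"
      using \<sigma>P by (auto simp: mix_profile_def mix_def profiles_def PiE_def extensional_def fun_eq_iff)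
    then have "(0, \<sigma>) \<in> ?Q" using V(2) \<sigma>P by (simp add: topspace_profile_top)
    ultimately have "\<exists>A B. openin ?T A \<and> openin ?P B \<and> 0 \<in> A \<and> \<sigma> \<in> B \<and> A \<times> B \<subseteq> ?Q"
      by (simp only: openin_prod_topology_alt)
    then obtain A B where AB: "openin ?T A" "openin ?P B" "0 \<in> A" "\<sigma> \<in> B" "A \<times> B \<subseteq> ?Q"
      by (elim exE conjE)
    obtain d where d: "d > 0" "\<And>r. r \<in> {0..1} \<Longrightarrow> dist r 0 < d \<Longrightarrow> r \<in> A"
      using AB(1,3) unfolding openin_euclidean_subtopology_iff by blast
    obtain m where m: "inverse (real (Suc m)) < d"
      using reals_Archimedean[OF d(1)] by blast
    \<comment> \<open>Membership in \<open>V\<close> makes \<kappa> n itself the required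
      \<open>k\<close>; membership in \<open>B\<close>, with a late index that brings
      \<open>t n\<close> into \<open>A\<close>, puts its perturbation \<open>s\<close> into
      \<open>V\<close>.\<close>
    have "\<exists>k. k \<in> \<kappa> ` {m..} \<and> k \<in> V \<inter> B"
      using \<sigma>[of m] openin_Int[OF V(1) AB(2)] V(2) AB(4) unfolding C_def in_closure_of by blast
    then obtain n where n: "m \<le> n" "\<kappa> n \<in> V" "\<kappa> n \<in> B" by auto
    have "t n \<le> inverse (real (Suc m))"
      using n(1) by (simp add: t_def inverse_eq_divide frac_le)
    then have "t n \<in> A" using m t[of n] by (intro d(2)) auto
    then have "(t n, \<kappa> n) \<in> ?Q" using n(3) by (intro subsetD[OF AB(5)]) simp
    then have sV: "mix_profile G (t n) (\<kappa> n) \<tau> \<in> V" by simp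
    have "profile_carrier G \<tau> \<subseteq> profile_carrier G (mix_profile G (t n) (\<kappa> n) \<tau>)"
      using \<kappa> t[of n] by (intro profile_carrier_mix(2)[OF game _ \<tau>]) auto
    then have "\<forall>\<rho>\<in>F. profile_carrier G \<rho> \<subseteq> profile_carrier G (mix_profile G (t n) (\<kappa> n) \<tau>)"
      using dom by (meson order_trans)
    then show ?thesis
      using \<kappa> by - (rule bexI[OF _ sV], rule bexI[OF _ n(2)], simp)
  qed
  then have "\<sigma> \<in> perfect_against G F"
    using \<sigma>P by (simp add: perfect_against_def)
  then show ?thesis by (metis empty_iff)
qed

section \<open>Finite intersection property\<close>

lemma perfect_equilibria_eq:
  "perfect_equilibria G = \<Inter>(perfect_against G ` {F. finite F \<and> F \<subseteq> profiles G})"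
proof (rule set_eqI)
  fix \<sigma>
  \<comment> \<open>By continuity every perfect profile is a Nash equilibrium, which absorbs that
    conjunct.\<close>
  have "\<sigma> \<in> perfect_equilibria G \<longleftrightarrow> perfect G \<sigma>"
    using perfect_imp_nash_equilibrium[OF continuous] by (auto simp: perfect_equilibria_def)
  also have "\<dots> \<longleftrightarrow> (\<forall>F. finite F \<and> F \<subseteq> profiles G \<longrightarrow> \<sigma> \<in> perfect_against G F)"
  proof
    show "perfect G \<sigma>" if "\<forall>F. finite F \<and> F \<subseteq> profiles G \<longrightarrow> \<sigma> \<in> perfect_against G F"
      by (rule perfect_against_imp_perfect) (simp add: that)
  qed (intro allI impI, elim conjE, rule perfect_imp_perfect_against)
  finally show "\<sigma> \<in> perfect_equilibria G \<longleftrightarrow>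
      \<sigma> \<in> \<Inter>(perfect_against G ` {F. finite F \<and> F \<subseteq> profiles G})"
    by simp
qed

text \<open>A finite subfamily is given by finitely many finite sets of profiles. By monotonicity
  its intersection contains the member for their union, which is non-empty.\<close>

lemma perfect_equilibria_nonempty: "perfect_equilibria G \<noteq> {}"
  unfolding perfect_equilibria_eq
proof (rule compact_space_profiles[unfolded compact_space_fip, rule_format], intro conjI ballI allI impI)
  fix \<D> assume "\<D> \<in> perfect_against G ` {F. finite F \<and> F \<subseteq> profiles G}"
  then show "closedin (profile_top G) \<D>" by (auto simp: closedin_perfect_against)
next
  fix \<F> assume "finite \<F> \<and> \<F> \<subseteq> perfect_against G ` {F. finite F \<and> F \<subseteq> profiles G}"
  then obtain \<C> where \<C>: "finite \<C>" "\<C> \<subseteq> {F. finite F \<and> F \<subseteq> profiles G}" "\<F> = perfect_against G ` \<C>"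
    by (meson finite_subset_image)
  have "perfect_against G (\<Union>\<C>) \<subseteq> perfect_against G F" if "F \<in> \<C>" for F
    using that by (intro perfect_against_mono) auto
  then have "perfect_against G (\<Union>\<C>) \<subseteq> \<Inter>\<F>" by (auto simp: \<C>(3))
  moreover have "perfect_against G (\<Union>\<C>) \<noteq> {}"
    using \<C>(1,2) by (intro perfect_against_nonempty) auto
  ultimately show "\<Inter>\<F> \<noteq> {}" by auto
qed

lemma compactin_perfect_equilibria: "compactin (profile_top G) (perfect_equilibria G)"
proof (rule closedin_compact_space[OF compact_space_profiles])
  show "closedin (profile_top G) (perfect_equilibria G)"
    unfolding perfect_equilibria_eq
    \<comment> \<open>The intersection is over a non-empty family, since \<open>{}\<close> is a
      finite set of profiles.\<close>
    by (rule closedin_Inter) (auto simp: closedin_perfect_against)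
qed

end

theorem theorem9:
  fixes G :: "'a game" and W :: "'v::real_vector topology" and e :: "'a profile \<Rightarrow> 'v"
  assumes "strategic_form_game G"
    and "locally_convex_tvs W"
    and "identifies_profiles G W e"
    and "compactin W (e ` profiles G)"
    and "convex (e ` profiles G)"
    and "\<And>i. i \<in> players G \<Longrightarrow> multilinear_payoff G i"
    and "\<And>i. i \<in> players G \<Longrightarrow> continuous_payoff G i"
  shows "perfect_equilibria G \<noteq> {} \<and> compactin (profile_top G) (perfect_equilibria G)"
proof -
  interpret compact_convex_game G W e
    by (rule compact_convex_game.intro) (fact assms)+
  show ?thesis
    by (intro conjI perfect_equilibria_nonempty compactin_perfect_equilibria)
qed

end
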